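(* Let $1<\alpha,\beta\le2$, let $K_1^{+},K_2^{+},K_1^{-},K_2^{-}\ge0$ be constants with $(K_1^{+})^2+(K_2^{+})^2\neq0$ and $(K_1^{-})^2+(K_2^{-})^2\neq0$, and let $(p,q)\in\{(1,0),(1,-1)\}$. The two-dimensional CN-WSGD difference scheme $$\Big(1-\frac{\tau}{2}\delta_x^\alpha\Big)\Big(1-\frac{\tau}{2}\delta_y^\beta\Big)U_{i,j}^{n+1}=\Big(1+\frac{\tau}{2}\delta_x^\alpha\Big)\Big(1+\frac{\tau}{2}\delta_y^\beta\Big)U_{i,j}^n+\tau f_{i,j}^{n+1/2},\qquad 1\le i,j\le N-1,\ 0\le n\le M-1,$$ with initial values $U_{i,j}^0=u_0(x_i,y_j)$ and boundary values $U_{i,j}^n=\varphi(x_i,y_j,t_n)$ at boundary grid points, is unconditionally stable.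
   Context: The scheme discretizes $\frac{\partial u}{\partial t}=K_1^{+}{}_aD_x^{\alpha}u+K_2^{+}{}_xD_b^{\alpha}u+K_1^{-}{}_cD_y^{\beta}u+K_2^{-}{}_yD_d^{\beta}u+f(x,y,t)$ on $\Omega\times[0,T]$, $\Omega=(a,b)\times(c,d)$, with $u(x,y,0)=u_0(x,y)$ on $\Omega$ and $u=\varphi$ on $\partial\Omega\times[0,T]$ (Riemann-Liouville derivatives), where $\varphi(a,y,t)=0$ if $K_1^{+}\ne0$, $\varphi(b,y,t)=0$ if $K_2^{+}\neq0$, $\varphi(x,c,t)=0$ if $K_1^{-}\ne0$, $\varphi(x,d,t)=0$ if $K_2^{-}\neq0$. The number of subintervals is the same in both directions, $N=N_x=N_y$, with equal step sizes $h=(b-a)/N=(d-c)/N$; $\tau=T/M$, $x_i=a+ih$, $y_j=c+jh$, $t_n=n\tau$, $t_{n+1/2}=(t_n+t_{n+1})/2$, $f_{i,j}^{n+1/2}=f(x_i,y_j,t_{n+1/2})$. For $\gamma\in\{\alpha,\beta\}$, with $g_0^{(\gamma)}=1$, $g_k^{(\gamma)}=\left(1-\frac{\gamma+1}{k}\right)g_{k-1}^{(\gamma)}$ ($k\ge1$), the coefficients are: for $(p,q)=(1,0)$: $w_0^{(\gamma)}=\frac{\gamma}{2}g_0^{(\gamma)}$, $w_k^{(\gamma)}=\frac{\gamma}{2}g_k^{(\gamma)}+\frac{2-\gamma}{2}g_{k-1}^{(\gamma)}$ for $k\ge1$; for $(p,q)=(1,-1)$: $w_0^{(\gamma)}=\frac{2+\gamma}{4}g_0^{(\gamma)}$,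 $w_1^{(\gamma)}=\frac{2+\gamma}{4}g_1^{(\gamma)}$, $w_k^{(\gamma)}=\frac{2+\gamma}{4}g_k^{(\gamma)}+\frac{2-\gamma}{4}g_{k-2}^{(\gamma)}$ for $k\ge2$. The difference operators are $$\delta_x^\alpha U_{i,j}=\frac{1}{h^\alpha}\Big(K_1^{+}\sum_{k=0}^{i+1}w_k^{(\alpha)}U_{i-k+1,j}+K_2^{+}\sum_{k=0}^{N-i+1}w_k^{(\alpha)}U_{i+k-1,j}\Big),\quad \delta_y^\beta U_{i,j}=\frac{1}{h^\beta}\Big(K_1^{-}\sum_{k=0}^{j+1}w_k^{(\beta)}U_{i,j-k+1}+K_2^{-}\sum_{k=0}^{N-j+1}w_k^{(\beta)}U_{i,j+k-1}\Big).$$ For $\gamma\in\{\alpha,\beta\}$ let $A_\gamma$ be the $(N-1)\times(N-1)$ matrix with entries $(A_\gamma)_{ij}=w_{i-j+1}^{(\gamma)}$ if $i-j+1\ge0$ and $0$ otherwise, and set (with $\otimes$ the Kronecker product, $I$ identity matrices of appropriate size) $$\mathcal{D}_x=\frac{\tau}{2h^{\alpha}}I\otimes\big(K_1^{+}A_{\alpha}+K_2^{+}A_{\alpha}^{\mathrm{T}}\big),\qquad \mathcal{D}_y=\frac{\tau}{2h^{\beta}}\big(K_1^{-}A_{\beta}+K_2^{-}A_{\beta}^{\mathrm{T}}\big)\otimes I.$$ Errors (differences of two solutions of the scheme with the same $f$ and boundary data), ordered lexicographically with the $x$-index running fastest, evolve by $(I-\mathcal{D}_x)(I-\mathcal{D}_y)e^{n+1}=(I+\mathcal{D}_x)(I+\mathcal{D}_y)e^{n}$.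 "Unconditionally stable" means that, for all step sizes $\tau>0$ and $h>0$ (with no relation between them required), $I-\mathcal{D}_x$ and $I-\mathcal{D}_y$ are invertible and the iteration matrix $(I-\mathcal{D}_y)^{-1}(I-\mathcal{D}_x)^{-1}(I+\mathcal{D}_x)(I+\mathcal{D}_y)$ has spectral radius less than one (equivalently, its powers converge to the zero matrix). *)

theory Defs
  imports "Jordan_Normal_Form.Spectral_Radius"
begin

subsection \<open>WSGD coefficients and difference operators\<close>

fun grunwald_coeff :: "real \<Rightarrow> nat \<Rightarrow> real" where
  "grunwald_coeff \<gamma> 0 = 1"
| "grunwald_coeff \<gamma> (Suc k) = (1 - (\<gamma> + 1) / real (Suc k)) * grunwald_coeff \<gamma> k"

text \<open>Only the shift pairs \<open>(1, 0)\<close> and \<open>(1, -1)\<close> are meaningful; other pairs get a dummy value.\<close>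

definition wsgd_weight :: "int \<times> int \<Rightarrow> real \<Rightarrow> nat \<Rightarrow> real" where
  "wsgd_weight pq \<gamma> k =
    (if pq = (1, 0) then
       (if k = 0 then \<gamma> / 2 * grunwald_coeff \<gamma> 0
        else \<gamma> / 2 * grunwald_coeff \<gamma> k + (2 - \<gamma>) / 2 * grunwald_coeff \<gamma> (k - 1))
     else if pq = (1, -1) then
       (if k < 2 then (2 + \<gamma>) / 4 * grunwald_coeff \<gamma> k
        else (2 + \<gamma>) / 4 * grunwald_coeff \<gamma> k + (2 - \<gamma>) / 4 * grunwald_coeff \<gamma> (k - 2))
     else 0)"

text \<open>The subtractions on natural numbers below never truncate where the operators are used:
  \<open>\<delta>\<^sub>x\<close> is evaluated only at \<open>1 \<le> i \<le> N - 1\<close> and \<open>\<delta>\<^sub>y\<close> only at \<open>1 \<le> j \<le> N - 1\<close>.\<close>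

definition delta_x ::
  "int \<times> int \<Rightarrow> real \<Rightarrow> real \<Rightarrow> real \<Rightarrow> nat \<Rightarrow> real \<Rightarrow> (nat \<Rightarrow> nat \<Rightarrow> real) \<Rightarrow> nat \<Rightarrow> nat \<Rightarrow> real" where
  "delta_x pq \<alpha> K1 K2 N h U i j =
    1 / h powr \<alpha> *
      (K1 * (\<Sum>k = 0..i + 1. wsgd_weight pq \<alpha> k * U (i + 1 - k) j) +
       K2 * (\<Sum>k = 0..N - i + 1. wsgd_weight pq \<alpha> k * U (i + k - 1) j))"

definition delta_y ::
  "int \<times> int \<Rightarrow> real \<Rightarrow> real \<Rightarrow> real \<Rightarrow> nat \<Rightarrow> real \<Rightarrow> (nat \<Rightarrow> nat \<Rightarrow> real) \<Rightarrow> nat \<Rightarrow> nat \<Rightarrow> real" where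
  "delta_y pq \<beta> K1 K2 N h U i j =
    1 / h powr \<beta> *
      (K1 * (\<Sum>k = 0..j + 1. wsgd_weight pq \<beta> k * U i (j + 1 - k)) +
       K2 * (\<Sum>k = 0..N - j + 1. wsgd_weight pq \<beta> k * U i (j + k - 1)))"

subsection \<open>The difference scheme\<close>

text \<open>\<open>U n i j\<close> is the grid value at time level \<open>n\<close> and grid point \<open>(a + i h, c + j h)\<close>. The
  constants \<open>K1p, K2p, K1m, K2m\<close> stand for \<open>K\<^sub>1\<^sup>+, K\<^sub>2\<^sup>+, K\<^sub>1\<^sup>-, K\<^sub>2\<^sup>-\<close>. The initial condition
  is imposed at the interior (open domain) and the boundary condition at all time levels,
  including \<open>n = 0\<close>.\<close>

definition cn_wsgd_solution ::
  "int \<times> int \<Rightarrow> real \<Rightarrow> real \<Rightarrow> real \<Rightarrow> real \<Rightarrow> real \<Rightarrow> real \<Rightarrow>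
   real \<Rightarrow> real \<Rightarrow> nat \<Rightarrow> nat \<Rightarrow> real \<Rightarrow> real \<Rightarrow>
   (real \<Rightarrow> real \<Rightarrow> real) \<Rightarrow> (real \<Rightarrow> real \<Rightarrow> real \<Rightarrow> real) \<Rightarrow> (real \<Rightarrow> real \<Rightarrow> real \<Rightarrow> real) \<Rightarrow>
   (nat \<Rightarrow> nat \<Rightarrow> nat \<Rightarrow> real) \<Rightarrow> bool" where
  "cn_wsgd_solution pq \<alpha> \<beta> K1p K2p K1m K2m a c N M h \<tau> u0 \<phi> f U \<longleftrightarrow>
    (let x = (\<lambda>i::nat. a + real i * h);
         y = (\<lambda>j::nat. c + real j * h);
         t = (\<lambda>n::nat. real n * \<tau>);
         dx = delta_x pq \<alpha> K1p K2p N h;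
         dy = delta_y pq \<beta> K1m K2m N h
     in
      (\<forall>i j. 1 \<le> i \<and> i \<le> N - 1 \<and> 1 \<le> j \<and> j \<le> N - 1 \<longrightarrow> U 0 i j = u0 (x i) (y j)) \<and>
      (\<forall>n i j. n \<le> M \<and> i \<le> N \<and> j \<le> N \<and> (i = 0 \<or> i = N \<or> j = 0 \<or> j = N)
         \<longrightarrow> U n i j = \<phi> (x i) (y j) (t n)) \<and>
      (\<forall>n i j. n < M \<and> 1 \<le> i \<and> i \<le> N - 1 \<and> 1 \<le> j \<and> j \<le> N - 1 \<longrightarrow>
         (let V = (\<lambda>i j. U (n + 1) i j - \<tau> / 2 * dy (U (n + 1)) i j);
              W = (\<lambda>i j. U n i j + \<tau> / 2 * dy (U n) i j)
          in V i j - \<tau> / 2 * dx V i j =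
             W i j + \<tau> / 2 * dx W i j + \<tau> * f (x i) (y j) ((t n + t (n + 1)) / 2))))"

subsection \<open>Matrix form and stability\<close>

definition kronecker_product :: "'a :: times mat \<Rightarrow> 'a mat \<Rightarrow> 'a mat" where
  "kronecker_product A B =
    mat (dim_row A * dim_row B) (dim_col A * dim_col B)
      (\<lambda>(i, j). A $$ (i div dim_row B, j div dim_col B) * B $$ (i mod dim_row B, j mod dim_col B))"

text \<open>Matrix indices start at \<open>0\<close>; the entries depend only on \<open>i - j\<close>.\<close>

definition wsgd_matrix :: "int \<times> int \<Rightarrow> real \<Rightarrow> nat \<Rightarrow> real mat" where
  "wsgd_matrix pq \<gamma> N =
    mat (N - 1) (N - 1) (\<lambda>(i, j). if j \<le> i + 1 then wsgd_weight pq \<gamma> (i + 1 - j) else 0)"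

definition D_x :: "int \<times> int \<Rightarrow> real \<Rightarrow> real \<Rightarrow> real \<Rightarrow> nat \<Rightarrow> real \<Rightarrow> real \<Rightarrow> real mat" where
  "D_x pq \<alpha> K1 K2 N h \<tau> =
    (let A = wsgd_matrix pq \<alpha> N
     in (\<tau> / (2 * h powr \<alpha>)) \<cdot>\<^sub>m
          kronecker_product (1\<^sub>m (N - 1)) (K1 \<cdot>\<^sub>m A + K2 \<cdot>\<^sub>m transpose_mat A))"

definition D_y :: "int \<times> int \<Rightarrow> real \<Rightarrow> real \<Rightarrow> real \<Rightarrow> nat \<Rightarrow> real \<Rightarrow> real \<Rightarrow> real mat" where
  "D_y pq \<beta> K1 K2 N h \<tau> =
    (let A = wsgd_matrix pq \<beta> N
     in (\<tau> / (2 * h powr \<beta>)) \<cdot>\<^sub>m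
          kronecker_product (K1 \<cdot>\<^sub>m A + K2 \<cdot>\<^sub>m transpose_mat A) (1\<^sub>m (N - 1)))"

text \<open>Lexicographic ordering of the interior grid points, the \<open>x\<close>-index running fastest.\<close>

definition grid_vec :: "nat \<Rightarrow> (nat \<Rightarrow> nat \<Rightarrow> real) \<Rightarrow> real vec" where
  "grid_vec N e = vec ((N - 1) * (N - 1)) (\<lambda>l. e (l mod (N - 1) + 1) (l div (N - 1) + 1))"

text \<open>The number \<open>N\<close> of subintervals and the step sizes \<open>\<tau>\<close>, \<open>h\<close> vary independently, so no relation
  between the step sizes is imposed. \<open>N \<ge> 2\<close> means that there are interior grid points.
  \<open>the (mat_inverse X)\<close> is the inverse of \<open>X\<close> whenever \<open>X\<close> is invertible.\<close>

definition cn_wsgd_unconditionally_stable ::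
  "int \<times> int \<Rightarrow> real \<Rightarrow> real \<Rightarrow> real \<Rightarrow> real \<Rightarrow> real \<Rightarrow> real \<Rightarrow> bool" where
  "cn_wsgd_unconditionally_stable pq \<alpha> \<beta> K1p K2p K1m K2m \<longleftrightarrow>
    (\<forall>N \<tau> h. 2 \<le> N \<and> 0 < \<tau> \<and> 0 < h \<longrightarrow>
      (let Dx = D_x pq \<alpha> K1p K2p N h \<tau>;
           Dy = D_y pq \<beta> K1m K2m N h \<tau>;
           I = 1\<^sub>m ((N - 1) * (N - 1))
       in invertible_mat (I - Dx) \<and> invertible_mat (I - Dy) \<and>
          spectral_radius (map_mat complex_of_real
            (the (mat_inverse (I - Dy)) * the (mat_inverse (I - Dx)) * (I + Dx) * (I + Dy))) < 1))"

end

theory Submission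
  imports Defs
begin

text \<open>The quadratic form of \<open>A\<^sub>\<gamma>\<close> is \<open>\<Sum>\<^sub>d c\<^sub>d P\<^sub>d\<close>, where \<open>P\<^sub>d = \<Sum>\<^sub>i x\<^sub>i x\<^bsub>i+d\<^esub>\<close> and \<open>c\<^sub>0 = w\<^sub>1\<close>,
  \<open>c\<^sub>1 = w\<^sub>0 + w\<^sub>2\<close>, \<open>c\<^sub>d = w\<^bsub>d+1\<^esub>\<close> for \<open>d \<ge> 2\<close>. The partial sums \<open>\<Sum>\<^bsub>k\<le>m\<^esub> w\<^sub>k\<close> with \<open>m \<ge> 3\<close> are
  nonpositive, and \<open>c\<^sub>1 > 0\<close>, \<open>c\<^sub>d \<ge> 0\<close> for \<open>d \<ge> 3\<close>, so \<open>P\<^sub>d \<le> P\<^sub>0\<close> and \<open>P\<^sub>1 < P\<^sub>0\<close> show that the form is negative when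
  \<open>c\<^sub>2 \<ge> 0\<close>. For \<open>(p, q) = (1, -1)\<close> the coefficient \<open>c\<^sub>2 = w\<^sub>3\<close> is negative if \<open>\<gamma> < 2\<close>; then
  \<open>P\<^sub>0 - P\<^sub>2 \<le> 4 (P\<^sub>0 - P\<^sub>1)\<close> and \<open>c\<^sub>1 + 4 c\<^sub>2 > 0\<close> still give negativity. Hence the forms of \<open>D_x\<close> and \<open>D_y\<close>
  are negative. If \<open>v\<close> is an eigenvector of the iteration matrix for \<open>\<mu>\<close>, then
  \<open>(I + D_x) u' = \<mu> (I - D_x) u\<close> with \<open>u = (I - D_y) v\<close> and \<open>u' = (I + D_y) v\<close>, and negativity gives
  \<open>|\<mu>| |u| \<le> |u'| < |u|\<close>.\<close>

subsection \<open>Signs of the weights and negativity of the Toeplitz form\<close>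

text \<open>The coefficients are those of (1 - z)^\<gamma>, so their partial sums are the
  coefficients of (1 - z)^(\<gamma> - 1), and the identity is absorption for binomial coefficients.
  It turns signs of partial sums into signs of coefficients.\<close>

lemma grunwald_coeff_Suc_partial_sum:
  "grunwald_coeff \<gamma> (Suc m) = - \<gamma> / real (Suc m) * (\<Sum>k\<le>m. grunwald_coeff \<gamma> k)"
proof (induction m)
  case 0
  show ?case by simp
next
  case (Suc m)
  define G where "G = (\<Sum>k\<le>m. grunwald_coeff \<gamma> k)"
  have "grunwald_coeff \<gamma> (Suc (Suc m)) =
      (1 - (\<gamma> + 1) / real (Suc (Suc m))) * (- \<gamma> / real (Suc m) * G)"
    using Suc by (simp add: G_def)
  also have "\<dots> = - \<gamma> / real (Suc (Suc m)) * (G + - \<gamma> / real (Suc m) * G)"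
    by (simp add: divide_simps) (simp add: algebra_simps)
  also have "G + - \<gamma> / real (Suc m) * G = (\<Sum>k\<le>Suc m. grunwald_coeff \<gamma> k)"
    using Suc by (simp add: G_def)
  finally show ?case .
qed

text \<open>By the previous identity, passing from \<open>m\<close> to \<open>Suc m\<close>
  multiplies the partial sum by 1 - \<gamma> / (m + 1). This factor is nonnegative because m + 1
  \<ge> 2 \<ge> \<gamma>, and the first value is 1 - \<gamma> \<le> 0.\<close>

lemma grunwald_partial_sum_nonpos:
  assumes "1 \<le> \<gamma>" "\<gamma> \<le> 2" "1 \<le> m"
  shows "(\<Sum>k\<le>m. grunwald_coeff \<gamma> k) \<le> 0"
  using assms(3)
proof (induction m rule: dec_induct)
  case base
  show ?case using assms by (simp add: field_simps)
next
  case (step m)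
  have "(\<Sum>k\<le>Suc m. grunwald_coeff \<gamma> k) = (1 - \<gamma> / real (Suc m)) * (\<Sum>k\<le>m. grunwald_coeff \<gamma> k)"
    using grunwald_coeff_Suc_partial_sum[of \<gamma> m] by (simp add: algebra_simps)
  moreover have "0 \<le> 1 - \<gamma> / real (Suc m)"
    using assms step by (simp add: field_simps)
  ultimately show ?case
    using step.IH by (simp add: mult_nonneg_nonpos)
qed

lemma grunwald_coeff_nonneg:
  assumes "1 \<le> \<gamma>" "\<gamma> \<le> 2" "2 \<le> k"
  shows "0 \<le> grunwald_coeff \<gamma> k"
proof -
  obtain m where k: "k = Suc m" and m: "1 \<le> m"
    using assms(3) by (cases k) auto
  show ?thesis
    unfolding k grunwald_coeff_Suc_partial_sum
    using grunwald_partial_sum_nonpos[OF assms(1,2) m] assms(1)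
    by (intro mult_nonpos_nonpos) auto
qed

section \<open>Partial sums and signs of the WSGD weights\<close>

text \<open>The weights are the coefficients of (\<gamma> / 2 + (2 - \<gamma>) / 2 z) (1 -
  z)^\<gamma>, so summation acts separately on the Grunwald sequence and on its shift.\<close>

lemma wsgd_weight_partial_sum_10:
  "(\<Sum>k\<le>Suc m. wsgd_weight (1, 0) \<gamma> k) =
    \<gamma> / 2 * (\<Sum>k\<le>Suc m. grunwald_coeff \<gamma> k) + (2 - \<gamma>) / 2 * (\<Sum>k\<le>m. grunwald_coeff \<gamma> k)"
  by (induction m) (simp_all add: wsgd_weight_def algebra_simps del: grunwald_coeff.simps)

text \<open>Here the shift is two; starting at \<open>m + 2\<close> lets the base case absorb the
  two weights that have no shifted part.\<close>

lemma wsgd_weight_partial_sum_1m1: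
  "(\<Sum>k\<le>m + 2. wsgd_weight (1, - 1) \<gamma> k) =
    (2 + \<gamma>) / 4 * (\<Sum>k\<le>m + 2. grunwald_coeff \<gamma> k) + (2 - \<gamma>) / 4 * (\<Sum>k\<le>m. grunwald_coeff \<gamma> k)"
proof (induction m)
  case 0
  show ?case
    by (simp add: wsgd_weight_def numeral_2_eq_2 field_simps del: grunwald_coeff.simps)
next
  case (Suc m)
  have "wsgd_weight (1, - 1) \<gamma> (Suc (m + 2)) =
      (2 + \<gamma>) / 4 * grunwald_coeff \<gamma> (Suc (m + 2)) + (2 - \<gamma>) / 4 * grunwald_coeff \<gamma> (Suc m)"
    by (simp add: wsgd_weight_def del: grunwald_coeff.simps)
  then show ?case
    using Suc by (simp add: distrib_left del: grunwald_coeff.simps)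
qed

text \<open>\<open>3 \<le> m\<close> keeps even the Grunwald sum up to \<open>m - 2\<close> at index
  1 or more, where it is nonpositive; up to index 0 it would be 1.\<close>

lemma wsgd_weight_partial_sum_nonpos:
  assumes "1 \<le> \<gamma>" "\<gamma> \<le> 2" and pq: "pq \<in> {(1, 0), (1, -1)}" and "3 \<le> m"
  shows "(\<Sum>k\<le>m. wsgd_weight pq \<gamma> k) \<le> 0"
proof -
  obtain l where l: "m = l + 2" "1 \<le> l"
    using \<open>3 \<le> m\<close> by (intro that[of "m - 2"]) auto
  have G: "(\<Sum>k\<le>j. grunwald_coeff \<gamma> k) \<le> 0" if "1 \<le> j" for j
    using grunwald_partial_sum_nonpos[OF assms(1,2) that] .
  consider "pq = (1, 0)" | "pq = (1, -1)"
    using pq by auto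
  then show ?thesis
  proof cases
    case 1
    have m: "m = Suc (Suc l)" using l by simp
    show ?thesis
      unfolding 1 m wsgd_weight_partial_sum_10 using G[of "Suc (Suc l)"] G[of "Suc l"] assms(1,2)
      by (intro add_nonpos_nonpos mult_nonneg_nonpos) auto
  next
    case 2
    show ?thesis
      unfolding 2 l wsgd_weight_partial_sum_1m1 using G[of "l + 2"] G[of l] assms(1,2) l
      by (intro add_nonpos_nonpos mult_nonneg_nonpos) auto
  qed
qed

text \<open>From \<open>k = 4\<close> on, both Grunwald indices are at least 2, also for the shift
  by two; the dummy value 0 covers all other pairs.\<close>

lemma wsgd_weight_nonneg:
  assumes "1 \<le> \<gamma>" "\<gamma> \<le> 2" "4 \<le> k"
  shows "0 \<le> wsgd_weight pq \<gamma> k"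
  unfolding wsgd_weight_def
  using assms by (auto intro!: add_nonneg_nonneg mult_nonneg_nonneg grunwald_coeff_nonneg)

lemma wsgd_weight_0_2_pos:
  assumes "1 < \<gamma>" "\<gamma> \<le> 2" and pq: "pq \<in> {(1, 0), (1, -1)}"
  shows "0 < wsgd_weight pq \<gamma> 0 + wsgd_weight pq \<gamma> 2"
proof -
  consider "pq = (1, 0)" | "pq = (1, -1)"
    using pq by auto
  then show ?thesis
  proof cases
    case 1
    \<comment> \<open>This vanishes at \<gamma> = 1, so the strict bound 1 < \<gamma> enters
      here.\<close>
    have eq: "wsgd_weight pq \<gamma> 0 + wsgd_weight pq \<gamma> 2 = \<gamma> * (\<gamma> + 2) * (\<gamma> - 1) / 4"
      by (simp add: 1 wsgd_weight_def numeral_2_eq_2 field_simps)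
    show ?thesis
      unfolding eq using assms by simp
  next
    case 2
    have eq: "wsgd_weight pq \<gamma> 0 + wsgd_weight pq \<gamma> 2 = 1 + (2 + \<gamma>) * \<gamma> * (\<gamma> - 1) / 8"
      by (simp add: 2 wsgd_weight_def numeral_2_eq_2 field_simps)
    show ?thesis
      unfolding eq using assms by (simp add: add_pos_nonneg)
  qed
qed

text \<open>The factor 4 is the constant of \<open>autocorr_second_difference\<close>; with it the
  lag-1 coefficient outweighs a negative weight at index 3.\<close>

lemma wsgd_weight_0_2_3_pos:
  assumes "1 < \<gamma>" "\<gamma> \<le> 2" and pq: "pq \<in> {(1, 0), (1, -1)}"
  shows "0 < wsgd_weight pq \<gamma> 0 + wsgd_weight pq \<gamma> 2 + 4 * wsgd_weight pq \<gamma> 3"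
proof -
  consider "pq = (1, 0)" | "pq = (1, -1)"
    using pq by auto
  then show ?thesis
  proof cases
    case 1
    have "0 \<le> wsgd_weight pq \<gamma> 3"
      using assms by (auto simp: 1 wsgd_weight_def intro!: add_nonneg_nonneg mult_nonneg_nonneg
          grunwald_coeff_nonneg)
    then show ?thesis
      using wsgd_weight_0_2_pos[OF assms] by simp
  next
    case 2
    \<comment> \<open>The left side vanishes at \<gamma> = 1, so \<gamma> - 1 splits off and only
      the sign of the cofactor remains to be found.\<close>
    have eq: "wsgd_weight pq \<gamma> 0 + wsgd_weight pq \<gamma> 2 + 4 * wsgd_weight pq \<gamma> 3 =
        (\<gamma> - 1) * (\<gamma> * (46 - 4 * \<gamma>\<^sup>2) + 3 * \<gamma>\<^sup>2 - 24) / 24"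
      by (simp add: 2 wsgd_weight_def numeral_2_eq_2 numeral_3_eq_3 field_simps)
    have "0 < \<gamma> * (46 - 4 * \<gamma>\<^sup>2) + 3 * \<gamma>\<^sup>2 - 24"
    proof -
      have "\<gamma>\<^sup>2 \<le> 2\<^sup>2"
        using assms by (intro power_mono) auto
      \<comment> \<open>46 - 4 * 4 = 30, which already exceeds 24.\<close>
      then have "1 * 30 \<le> \<gamma> * (46 - 4 * \<gamma>\<^sup>2)"
        using assms by (intro mult_mono) auto
      then show ?thesis
        using zero_le_power2[of \<gamma>] by linarith
    qed
    then show ?thesis
      unfolding eq using assms by (intro divide_pos_pos mult_pos_pos) auto
  qed
qed

section \<open>Autocorrelations of finitely supported sequences\<close>

text \<open>The factor \<open>x (i + d)\<close> may reach past \<open>n\<close>. Sequences are taken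
  to vanish from \<open>n\<close> on, which spares an upper limit depending on
  \<open>d\<close>.\<close>

definition autocorr :: "nat \<Rightarrow> (nat \<Rightarrow> real) \<Rightarrow> nat \<Rightarrow> real" where
  "autocorr n x d = (\<Sum>i<n. x i * x (i + d))"

text \<open>The subtracted terms become the left boundary terms when squared differences are
  expanded.\<close>

lemma sum_shift_support:
  fixes f :: "nat \<Rightarrow> real"
  assumes "\<And>i. n \<le> i \<Longrightarrow> f i = 0"
  shows "(\<Sum>i<n. f (i + d)) = (\<Sum>i<n. f i) - (\<Sum>i<d. f i)"
proof -
  have "(\<Sum>i<n. f (i + d)) = (\<Sum>i\<in>{d..<n + d}. f i)"
    by (simp add: lessThan_atLeast0 sum.shift_bounds_nat_ivl[of f 0 d n, symmetric, simplified])
  also have "\<dots> = (\<Sum>i<n + d. f i) - (\<Sum>i<d. f i)"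
    using sum_diff_nat_ivl[of 0 d "n + d" f] by (simp add: lessThan_atLeast0)
  also have "(\<Sum>i<n + d. f i) = (\<Sum>i<n. f i)"
    using assms by (intro sum.mono_neutral_right) auto
  finally show ?thesis .
qed

text \<open>Expand the sum of squares of \<open>x i - x (i + d)\<close>; the shifted sum of squares
  is at most the unshifted one.\<close>

lemma autocorr_le:
  assumes supp: "\<And>i. n \<le> i \<Longrightarrow> x i = 0"
  shows "autocorr n x d \<le> autocorr n x 0"
proof -
  have "0 \<le> (\<Sum>i<n. (x i - x (i + d))\<^sup>2)"
    by (simp add: sum_nonneg)
  also have "\<dots> = (\<Sum>i<n. (x i)\<^sup>2) + (\<Sum>i<n. (x (i + d))\<^sup>2) - 2 * autocorr n x d"
    by (simp add: autocorr_def power2_diff sum.distrib sum_subtractf sum_distrib_left mult.assoc)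
  also have "(\<Sum>i<n. (x (i + d))\<^sup>2) \<le> (\<Sum>i<n. (x i)\<^sup>2)"
    using supp by (simp add: sum_shift_support[of n "\<lambda>i. (x i)\<^sup>2"] sum_nonneg)
  finally show ?thesis
    by (simp add: autocorr_def power2_eq_square)
qed

text \<open>Equality would make all differences of the zero-extended sequence vanish, so the
  sequence would be constant and hence zero.\<close>

lemma autocorr_1_less:
  assumes supp: "\<And>i. n \<le> i \<Longrightarrow> x i = 0" and nz: "x k \<noteq> 0"
  shows "autocorr n x 1 < autocorr n x 0"
proof (rule ccontr)
  have "0 < n"
    using supp[of k] nz by (cases n) auto
  have "(\<Sum>i<n. (x i - x (i + 1))\<^sup>2) =
      (\<Sum>i<n. (x i)\<^sup>2) + (\<Sum>i<n. (x (i + 1))\<^sup>2) - 2 * autocorr n x 1"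
    by (simp add: autocorr_def power2_diff sum.distrib sum_subtractf sum_distrib_left mult.assoc)
  \<comment> \<open>The term \<open>(x 0)\<^sup>2\<close> is the squared difference across the left
    end, lost by the shift.\<close>
  then have id: "2 * autocorr n x 0 - 2 * autocorr n x 1 = (x 0)\<^sup>2 + (\<Sum>i<n. (x i - x (i + 1))\<^sup>2)"
    using sum_shift_support[of n "\<lambda>i. (x i)\<^sup>2" 1] supp
    by (simp add: autocorr_def power2_eq_square)
  assume "\<not> autocorr n x 1 < autocorr n x 0"
  then have le: "(x 0)\<^sup>2 + (\<Sum>i<n. (x i - x (i + 1))\<^sup>2) \<le> 0"
    using id by linarith
  have nonneg: "0 \<le> (\<Sum>i<n. (x i - x (i + 1))\<^sup>2)"
    by (rule sum_nonneg) simp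
  have "(x 0)\<^sup>2 \<le> 0" and sum0: "(\<Sum>i<n. (x i - x (i + 1))\<^sup>2) = 0"
    using le nonneg zero_le_power2[of "x 0"] by linarith+
  then have x0: "x 0 = 0"
    by simp
  have step: "x i = x (i + 1)" if "i < n" for i
    using that sum0 by (subst (asm) sum_nonneg_eq_0_iff) auto
  have "x i = 0" for i
  proof (induction i)
    case (Suc i)
    then show ?case
      using step[of i] supp[of "Suc i"] by (cases "i < n") auto
  qed (rule x0)
  with nz show False by simp
qed

text \<open>The second differences of the sequence extended by zero to the integers are squared here;
  the terms at indices \<open>-1\<close> and \<open>-2\<close> are \<open>x 1 - 2 * x 0\<close> and \<open>x 0\<close>.\<close>

lemma autocorr_second_difference:
  assumes supp: "\<And>i. n \<le> i \<Longrightarrow> x i = 0"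
  shows "autocorr n x 0 - autocorr n x 2 \<le> 4 * (autocorr n x 0 - autocorr n x 1)"
proof -
  let ?Q = "\<Sum>i<n. (x i - 2 * x (i + 1) + x (i + 2))\<^sup>2"
  have sq: "(\<Sum>i<n. (x (i + d))\<^sup>2) = (\<Sum>i<n. (x i)\<^sup>2) - (\<Sum>i<d. (x i)\<^sup>2)" for d
    using supp by (intro sum_shift_support) simp
  have pr: "(\<Sum>i<n. x (i + 1) * x (i + 2)) = autocorr n x 1 - x 0 * x 1"
    using sum_shift_support[of n "\<lambda>i. x i * x (i + 1)" 1] supp by (simp add: autocorr_def)
  have "?Q = (\<Sum>i<n. (x i)\<^sup>2 + 4 * (x (i + 1))\<^sup>2 + (x (i + 2))\<^sup>2 - 4 * (x i * x (i + 1))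
      + 2 * (x i * x (i + 2)) - 4 * (x (i + 1) * x (i + 2)))"
    by (intro sum.cong) (auto simp: power2_eq_square algebra_simps)
  also have "\<dots> = (\<Sum>i<n. (x i)\<^sup>2) + 4 * (\<Sum>i<n. (x (i + 1))\<^sup>2) + (\<Sum>i<n. (x (i + 2))\<^sup>2)
      - 4 * autocorr n x 1 + 2 * autocorr n x 2 - 4 * (\<Sum>i<n. x (i + 1) * x (i + 2))"
    unfolding autocorr_def sum.distrib sum_subtractf sum_distrib_left ..
  \<comment> \<open>The terms lost by shifting, -5 (x 0)^2 - (x 1)^2 + 4 x 0 x 1, are exactly minus
    the two displayed squares. Half of what remains, 3 P_0 - 4 P_1 + P_2, is the difference of the
    two sides of the claim.\<close>
  also have "\<dots> = 6 * autocorr n x 0 - 8 * autocorr n x 1 + 2 * autocorr n x 2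
      - (x 1 - 2 * x 0)\<^sup>2 - (x 0)\<^sup>2"
    unfolding sq pr by (simp add: autocorr_def power2_eq_square numeral_2_eq_2 algebra_simps)
  finally have "?Q + (x 1 - 2 * x 0)\<^sup>2 + (x 0)\<^sup>2 =
      6 * autocorr n x 0 - 8 * autocorr n x 1 + 2 * autocorr n x 2"
    by simp
  moreover have "0 \<le> ?Q + (x 1 - 2 * x 0)\<^sup>2 + (x 0)\<^sup>2"
    by (intro add_nonneg_nonneg sum_nonneg) auto
  ultimately show ?thesis by simp
qed

section \<open>The Hessenberg-Toeplitz form as a combination of autocorrelations\<close>

text \<open>Entries are collected by diagonals: the superdiagonal contributes lag 1, the
  \<open>d\<close>-th subdiagonal lag \<open>d\<close>. Lags from \<open>n\<close> on vanish, so
  \<open>m\<close> is free above \<open>n\<close>.\<close>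

lemma hessenberg_toeplitz_form:
  assumes supp: "\<And>i. n \<le> i \<Longrightarrow> x i = 0" and "n \<le> m"
  shows "(\<Sum>i<n. \<Sum>j<n. (if j \<le> i + 1 then w (i + 1 - j) else 0) * x i * x j) =
    w 0 * autocorr n x 1 + (\<Sum>d<m. w (d + 1) * autocorr n x d)"
proof -
  have inner: "(\<Sum>i<n. (if j \<le> i + 1 then w (i + 1 - j) else 0) * x i * x j) =
      (if j = 0 then 0 else w 0 * x (j - 1) * x j) + (\<Sum>d<m. w (d + 1) * (x j * x (j + d)))"
    if "j < n" for j
  proof -
    \<comment> \<open>Extending the rows to \<open>j + m\<close> gives every column the same range
      of lags, independent of \<open>j\<close>.\<close>
    have "(\<Sum>i<n. (if j \<le> i + 1 then w (i + 1 - j) else 0) * x i * x j) =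
        (\<Sum>i<j + m. (if j \<le> i + 1 then w (i + 1 - j) else 0) * x i * x j)"
      using supp \<open>n \<le> m\<close> by (intro sum.mono_neutral_left) auto
    also have "\<dots> = (\<Sum>i<j. (if j \<le> i + 1 then w (i + 1 - j) else 0) * x i * x j) +
        (\<Sum>i\<in>{j..<j + m}. (if j \<le> i + 1 then w (i + 1 - j) else 0) * x i * x j)"
      unfolding lessThan_atLeast0 by (rule sum.atLeastLessThan_concat[symmetric]) auto
    \<comment> \<open>Above the diagonal only \<open>i = j - 1\<close> survives.\<close>
    also have "(\<Sum>i<j. (if j \<le> i + 1 then w (i + 1 - j) else 0) * x i * x j) =
        (if j = 0 then 0 else w 0 * x (j - 1) * x j)"
      by (cases j) (auto intro!: sum.neutral)
    also have "(\<Sum>i\<in>{j..<j + m}. (if j \<le> i + 1 then w (i + 1 - j) else 0) * x i * x j) =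
        (\<Sum>d<m. w (d + 1) * (x j * x (j + d)))"
      by (rule sum.reindex_bij_witness[of _ "\<lambda>d. j + d" "\<lambda>i. i - j"]) (auto simp: Suc_diff_le)
    finally show ?thesis .
  qed
  have "(\<Sum>i<n. \<Sum>j<n. (if j \<le> i + 1 then w (i + 1 - j) else 0) * x i * x j) =
      (\<Sum>j<n. (if j = 0 then 0 else w 0 * x (j - 1) * x j) +
        (\<Sum>d<m. w (d + 1) * (x j * x (j + d))))"
    by (subst sum.swap) (intro sum.cong refl inner, simp)
  also have "\<dots> = (\<Sum>j<n. if j = 0 then 0 else w 0 * x (j - 1) * x j) +
      (\<Sum>d<m. w (d + 1) * autocorr n x d)"
    unfolding sum.distrib autocorr_def sum_distrib_left by (subst sum.swap) simp
  also have "(\<Sum>j<n. if j = 0 then 0 else w 0 * x (j - 1) * x j) = w 0 * autocorr n x 1"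
  proof (cases n)
    case (Suc l)
    have "(\<Sum>j<n. if j = 0 then 0 else w 0 * x (j - 1) * x j) = (\<Sum>j<l. w 0 * x j * x (Suc j))"
      unfolding Suc by (subst sum.lessThan_Suc_shift) simp
    then show ?thesis
      using supp[of "Suc l"] by (simp add: autocorr_def Suc sum_distrib_left mult.assoc)
  qed (simp add: autocorr_def)
  finally show ?thesis .
qed

lemma hessenberg_toeplitz_form_neg:
  fixes w :: "nat \<Rightarrow> real"
  assumes c1: "0 < w 0 + w 2" and c2: "0 < w 0 + w 2 + 4 * w 3"
    and nonneg: "\<And>k. 4 \<le> k \<Longrightarrow> 0 \<le> w k"
    and sum_le: "\<And>m. 3 \<le> m \<Longrightarrow> (\<Sum>k\<le>m. w k) \<le> 0"
    and supp: "\<And>i. n \<le> i \<Longrightarrow> x i = 0" and nz: "x k \<noteq> 0"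
  shows "(\<Sum>i<n. \<Sum>j<n. (if j \<le> i + 1 then w (i + 1 - j) else 0) * x i * x j) < 0"
proof -
  let ?P = "autocorr n x"
  \<comment> \<open>The limit \<open>n + 3\<close> allows lags 0, 1 and 2 to be split off for every
    \<open>n\<close>.\<close>
  have "(\<Sum>i<n. \<Sum>j<n. (if j \<le> i + 1 then w (i + 1 - j) else 0) * x i * x j) =
      w 0 * ?P 1 + (\<Sum>d<n + 3. w (d + 1) * ?P d)"
    by (rule hessenberg_toeplitz_form) (auto simp: supp)
  also have "(\<Sum>d<n + 3. w (d + 1) * ?P d) =
      w 1 * ?P 0 + w 2 * ?P 1 + w 3 * ?P 2 + (\<Sum>d<n. w (d + 4) * ?P (d + 3))"
    by (simp add: sum.lessThan_Suc_shift numeral_eq_Suc del: sum.lessThan_Suc)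
  also have "(\<Sum>d<n. w (d + 4) * ?P (d + 3)) \<le> (\<Sum>d<n. w (d + 4) * ?P 0)"
    by (intro sum_mono mult_left_mono autocorr_le nonneg) (auto simp: supp)
  \<comment> \<open>Writing P_d = P_0 - (P_0 - P_d) for d = 1, 2 collects a full partial sum of the
    weights in front of P_0.\<close>
  also have "w 0 * ?P 1 + (w 1 * ?P 0 + w 2 * ?P 1 + w 3 * ?P 2 + (\<Sum>d<n. w (d + 4) * ?P 0)) =
      (\<Sum>k\<le>n + 3. w k) * ?P 0 - ((w 0 + w 2) * (?P 0 - ?P 1) + w 3 * (?P 0 - ?P 2))"
    by (simp add: lessThan_Suc_atMost[symmetric] sum.lessThan_Suc_shift numeral_eq_Suc
        sum_distrib_left algebra_simps del: sum.lessThan_Suc)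
  also have "\<dots> < 0"
  proof -
    have P0: "0 \<le> ?P 0"
      by (simp add: autocorr_def sum_nonneg)
    have P1: "0 < ?P 0 - ?P 1"
      using autocorr_1_less[of n x k] supp nz by simp
    have P2: "0 \<le> ?P 0 - ?P 2"
      using autocorr_le[of n x 2] supp by simp
    have "0 < (w 0 + w 2) * (?P 0 - ?P 1) + w 3 * (?P 0 - ?P 2)"
    proof (cases "0 \<le> w 3")
      case True
      then show ?thesis
        using c1 P1 P2 by (simp add: add_pos_nonneg)
    next
      case False
      have "0 < (w 0 + w 2 + 4 * w 3) * (?P 0 - ?P 1)"
        using c2 P1 by simp
      also have "\<dots> = (w 0 + w 2) * (?P 0 - ?P 1) + w 3 * (4 * (?P 0 - ?P 1))"
        by (simp add: algebra_simps)
      \<comment> \<open>As \<open>w 3\<close> is negative, the upper bound on P_0 - P_2 becomes a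
        lower bound for the product.\<close>
      also have "w 3 * (4 * (?P 0 - ?P 1)) \<le> w 3 * (?P 0 - ?P 2)"
        using False autocorr_second_difference[of n x] supp by (intro mult_left_mono_neg) auto
      finally show ?thesis by simp
    qed
    moreover have "(\<Sum>k\<le>n + 3. w k) * ?P 0 \<le> 0"
      using sum_le P0 by (simp add: mult_nonpos_nonneg)
    ultimately show ?thesis by simp
  qed
  finally show ?thesis by simp
qed

subsection \<open>Negative definite matrices and Kronecker products\<close>

text \<open>The matrix need not be symmetric: this is negative definiteness of its symmetric
  part.\<close>

definition neg_definite :: "real mat \<Rightarrow> bool" where
  "neg_definite A \<longleftrightarrow> (\<forall>v\<in>carrier_vec (dim_row A). v \<noteq> 0\<^sub>v (dim_row A) \<longrightarrow> v \<bullet> (A *\<^sub>v v) < 0)"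

lemma quadratic_form_sum:
  fixes A :: "real mat"
  assumes "A \<in> carrier_mat n n" "v \<in> carrier_vec n"
  shows "v \<bullet> (A *\<^sub>v v) = (\<Sum>i<n. \<Sum>j<n. A $$ (i, j) * v $ i * v $ j)"
  using assms
  by (auto simp: scalar_prod_def lessThan_atLeast0 sum_distrib_left intro!: sum.cong)

text \<open>Vectors are replaced by functions extended by zero, the form in which the
  autocorrelation lemmas apply.\<close>

lemma neg_definiteI:
  assumes "A \<in> carrier_mat n n"
    and "\<And>x :: nat \<Rightarrow> real. (\<And>i. n \<le> i \<Longrightarrow> x i = 0) \<Longrightarrow> \<exists>i<n. x i \<noteq> 0 \<Longrightarrow>
      (\<Sum>i<n. \<Sum>j<n. A $$ (i, j) * x i * x j) < 0"
  shows "neg_definite A"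
  unfolding neg_definite_def
proof (intro ballI impI)
  fix v :: "real vec"
  assume v: "v \<in> carrier_vec (dim_row A)" "v \<noteq> 0\<^sub>v (dim_row A)"
  define x where "x i = (if i < n then v $ i else 0)" for i
  have "\<exists>i<n. x i \<noteq> 0"
    using v assms(1) by (auto simp: x_def vec_eq_iff)
  then have "(\<Sum>i<n. \<Sum>j<n. A $$ (i, j) * x i * x j) < 0"
    by (intro assms(2)) (auto simp: x_def)
  then show "v \<bullet> (A *\<^sub>v v) < 0"
    using v assms(1) by (simp add: quadratic_form_sum[OF assms(1)] x_def)
qed

lemma neg_definiteD:
  fixes x :: "nat \<Rightarrow> real"
  assumes "neg_definite A" "A \<in> carrier_mat n n" "\<exists>i<n. x i \<noteq> 0"
  shows "(\<Sum>i<n. \<Sum>j<n. A $$ (i, j) * x i * x j) < 0"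
proof -
  have "vec n x \<in> carrier_vec n" "vec n x \<noteq> 0\<^sub>v n"
    using assms(3) by (auto simp: vec_eq_iff)
  then have "vec n x \<bullet> (A *\<^sub>v vec n x) < 0"
    using assms(1,2) unfolding neg_definite_def by auto
  then show ?thesis
    by (simp add: quadratic_form_sum[OF assms(2)])
qed

lemma neg_definite_form_nonpos:
  fixes x :: "nat \<Rightarrow> real"
  assumes "neg_definite A" "A \<in> carrier_mat n n"
  shows "(\<Sum>i<n. \<Sum>j<n. A $$ (i, j) * x i * x j) \<le> 0"
proof (cases "\<exists>i<n. x i \<noteq> 0")
  case True
  then show ?thesis
    using neg_definiteD[OF assms] by (simp add: less_imp_le)
qed simp

lemma neg_definite_smult:
  assumes "neg_definite A" "A \<in> carrier_mat n n" "0 < c"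
  shows "neg_definite (c \<cdot>\<^sub>m A)"
proof (rule neg_definiteI)
  fix x :: "nat \<Rightarrow> real"
  assume "\<exists>i<n. x i \<noteq> 0"
  then have "c * (\<Sum>i<n. \<Sum>j<n. A $$ (i, j) * x i * x j) < 0"
    using neg_definiteD[OF assms(1,2)] assms(3) by (simp add: mult_pos_neg)
  then show "(\<Sum>i<n. \<Sum>j<n. (c \<cdot>\<^sub>m A) $$ (i, j) * x i * x j) < 0"
    using assms(2) by (simp add: sum_distrib_left mult.assoc)
qed (use assms in auto)

text \<open>A matrix and its transpose have the same quadratic form, so the combination has
  \<open>K + L\<close> times that form.\<close>

lemma neg_definite_add_transpose:
  assumes "neg_definite A" "A \<in> carrier_mat n n" "0 \<le> K" "0 \<le> L" "0 < K + L"
  shows "neg_definite (K \<cdot>\<^sub>m A + L \<cdot>\<^sub>m transpose_mat A)"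
proof (rule neg_definiteI)
  fix x :: "nat \<Rightarrow> real"
  assume nz: "\<exists>i<n. x i \<noteq> 0"
  let ?S = "\<Sum>i<n. \<Sum>j<n. A $$ (i, j) * x i * x j"
  have "(\<Sum>i<n. \<Sum>j<n. (K \<cdot>\<^sub>m A + L \<cdot>\<^sub>m transpose_mat A) $$ (i, j) * x i * x j) =
      K * ?S + L * (\<Sum>i<n. \<Sum>j<n. A $$ (j, i) * x i * x j)"
    using assms(2) by (simp add: sum_distrib_left sum.distrib algebra_simps)
  also have "(\<Sum>i<n. \<Sum>j<n. A $$ (j, i) * x i * x j) = ?S"
    by (subst sum.swap) (simp add: algebra_simps)
  also have "K * ?S + L * ?S = (K + L) * ?S"
    by (simp add: algebra_simps)
  also have "\<dots> < 0"
    using neg_definiteD[OF assms(1,2) nz] assms(5) by (simp add: mult_pos_neg)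
  finally show "(\<Sum>i<n. \<Sum>j<n. (K \<cdot>\<^sub>m A + L \<cdot>\<^sub>m transpose_mat A) $$ (i, j) * x i * x j) < 0" .
qed (use assms in auto)

lemma wsgd_matrix_carrier: "wsgd_matrix pq \<gamma> N \<in> carrier_mat (N - 1) (N - 1)"
  by (simp add: wsgd_matrix_def)

lemma neg_definite_wsgd_matrix:
  assumes "1 < \<gamma>" "\<gamma> \<le> 2" and pq: "pq \<in> {(1, 0), (1, -1)}"
  shows "neg_definite (wsgd_matrix pq \<gamma> N)"
proof (rule neg_definiteI[OF wsgd_matrix_carrier])
  fix x :: "nat \<Rightarrow> real"
  assume supp: "\<And>i. N - 1 \<le> i \<Longrightarrow> x i = 0" and "\<exists>i<N - 1. x i \<noteq> 0"
  then obtain k where "x k \<noteq> 0"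
    by auto
  then have "(\<Sum>i<N - 1. \<Sum>j<N - 1.
      (if j \<le> i + 1 then wsgd_weight pq \<gamma> (i + 1 - j) else 0) * x i * x j) < 0"
    using assms wsgd_weight_0_2_pos[OF assms] wsgd_weight_0_2_3_pos[OF assms]
    by (intro hessenberg_toeplitz_form_neg wsgd_weight_nonneg wsgd_weight_partial_sum_nonpos)
       (auto simp: supp)
  then show "(\<Sum>i<N - 1. \<Sum>j<N - 1. wsgd_matrix pq \<gamma> N $$ (i, j) * x i * x j) < 0"
    by (simp add: wsgd_matrix_def)
qed

section \<open>Kronecker products with an identity factor\<close>

lemma sum_div_mod:
  fixes f :: "nat \<Rightarrow> nat \<Rightarrow> 'a :: comm_monoid_add"
  shows "(\<Sum>l<m * k. f (l div k) (l mod k)) = (\<Sum>s<m. \<Sum>r<k. f s r)"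
proof -
  have "(\<Sum>l<m * k. f (l div k) (l mod k)) = (\<Sum>s<m. \<Sum>l\<in>{s * k..<s * k + k}. f (l div k) (l mod k))"
    by (rule sum.nat_group[symmetric])
  also have "\<dots> = (\<Sum>s<m. \<Sum>r<k. f s r)"
  proof (rule sum.cong[OF refl])
    fix s
    show "(\<Sum>l\<in>{s * k..<s * k + k}. f (l div k) (l mod k)) = (\<Sum>r<k. f s r)"
      by (rule sum.reindex_bij_witness[of _ "\<lambda>r. s * k + r" "\<lambda>l. l - s * k"])
        (auto simp: algebra_simps intro!: arg_cong2[where f = f] div_nat_eqI[symmetric] mod_nat_eqI[symmetric])
  qed
  finally show ?thesis .
qed

lemma kronecker_product_carrier:
  assumes "A \<in> carrier_mat m m" "B \<in> carrier_mat k k"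
  shows "kronecker_product A B \<in> carrier_mat (m * k) (m * k)"
  using assms by (auto simp: kronecker_product_def)

lemma kronecker_product_form:
  assumes "A \<in> carrier_mat m m" "B \<in> carrier_mat k k"
  shows "(\<Sum>i<m * k. \<Sum>j<m * k. kronecker_product A B $$ (i, j) * x i * x j) =
    (\<Sum>s<m. \<Sum>r<k. \<Sum>s'<m. \<Sum>r'<k. A $$ (s, s') * B $$ (r, r') * x (s * k + r) * x (s' * k + r') :: real)"
proof -
  define g where "g s r s' r' = A $$ (s, s') * B $$ (r, r') * x (s * k + r) * x (s' * k + r')"
    for s r s' r'
  have "(\<Sum>i<m * k. \<Sum>j<m * k. kronecker_product A B $$ (i, j) * x i * x j) =
      (\<Sum>i<m * k. \<Sum>j<m * k. g (i div k) (i mod k) (j div k) (j mod k))"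
    using assms by (auto simp: kronecker_product_def g_def intro!: sum.cong)
  also have "\<dots> = (\<Sum>i<m * k. \<Sum>s'<m. \<Sum>r'<k. g (i div k) (i mod k) s' r')"
    by (intro sum.cong refl sum_div_mod)
  also have "\<dots> = (\<Sum>s<m. \<Sum>r<k. \<Sum>s'<m. \<Sum>r'<k. g s r s' r')"
    by (rule sum_div_mod)
  finally show ?thesis
    by (simp add: g_def)
qed

lemma div_mod_less:
  fixes l :: nat
  assumes "l < m * k"
  shows "l div k < m" "l mod k < k"
proof -
  have "0 < k"
    using assms by (cases k) auto
  then show "l div k < m" "l mod k < k"
    using assms by (auto simp: less_mult_imp_div_less)
qed

lemma exists_block_nonzero:
  fixes x :: "nat \<Rightarrow> real"
  assumes "\<exists>i<m * k. x i \<noteq> 0"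
  shows "\<exists>s<m. \<exists>r<k. x (s * k + r) \<noteq> 0"
proof -
  obtain i where i: "i < m * k" "x i \<noteq> 0"
    using assms by auto
  then show ?thesis
    using div_mod_less[OF i(1)] by (intro exI[of _ "i div k"] conjI exI[of _ "i mod k"]) auto
qed

text \<open>The matrix is block diagonal: its form is the sum of the forms of \<open>B\<close> on
  the consecutive blocks of \<open>x\<close>. All are nonpositive, and a nonzero block gives
  strictness.\<close>

lemma neg_definite_kronecker_one_left:
  assumes "neg_definite B" "B \<in> carrier_mat k k"
  shows "neg_definite (kronecker_product (1\<^sub>m m) B)"
proof (rule neg_definiteI)
  show "kronecker_product (1\<^sub>m m) B \<in> carrier_mat (m * k) (m * k)"
    using assms by (simp add: kronecker_product_carrier)
  fix x :: "nat \<Rightarrow> real"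
  assume "\<exists>i<m * k. x i \<noteq> 0"
  from exists_block_nonzero[OF this]
  obtain s r where s: "s < m" "r < k" "x (s * k + r) \<noteq> 0" by auto
  have "(\<Sum>i<m * k. \<Sum>j<m * k. kronecker_product (1\<^sub>m m) B $$ (i, j) * x i * x j) =
      (\<Sum>s<m. \<Sum>r<k. \<Sum>r'<k. B $$ (r, r') * x (s * k + r) * x (s * k + r'))"
    unfolding kronecker_product_form[OF one_carrier_mat assms(2)]
  proof (rule sum.cong[OF refl], rule sum.cong[OF refl])
    fix s r
    assume s: "s \<in> {..<m}"
    show "(\<Sum>s'<m. \<Sum>r'<k. 1\<^sub>m m $$ (s, s') * B $$ (r, r') * x (s * k + r) * x (s' * k + r')) =
        (\<Sum>r'<k. B $$ (r, r') * x (s * k + r) * x (s * k + r'))"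
      using s by (subst sum.swap) (simp add: if_distrib if_distribR cong: if_cong)
  qed
  also have "\<dots> < (\<Sum>s<m. 0)"
    using s neg_definite_form_nonpos[OF assms] neg_definiteD[OF assms, of "\<lambda>r. x (s * k + r)"]
    by (intro sum_strict_mono_ex1) auto
  finally show "(\<Sum>i<m * k. \<Sum>j<m * k. kronecker_product (1\<^sub>m m) B $$ (i, j) * x i * x j) < 0"
    by simp
qed

text \<open>Now the form splits over the residues \<open>r\<close> modulo \<open>k\<close>, with
  \<open>A\<close> acting on the strided slices \<open>x (s * k + r)\<close>.\<close>

lemma neg_definite_kronecker_one_right:
  assumes "neg_definite A" "A \<in> carrier_mat m m"
  shows "neg_definite (kronecker_product A (1\<^sub>m k))"
proof (rule neg_definiteI)
  show "kronecker_product A (1\<^sub>m k) \<in> carrier_mat (m * k) (m * k)"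
    using assms by (simp add: kronecker_product_carrier)
  fix x :: "nat \<Rightarrow> real"
  assume "\<exists>i<m * k. x i \<noteq> 0"
  from exists_block_nonzero[OF this]
  obtain s r where s: "s < m" "r < k" "x (s * k + r) \<noteq> 0" by auto
  have "(\<Sum>i<m * k. \<Sum>j<m * k. kronecker_product A (1\<^sub>m k) $$ (i, j) * x i * x j) =
      (\<Sum>s<m. \<Sum>r<k. \<Sum>s'<m. A $$ (s, s') * x (s * k + r) * x (s' * k + r))"
    unfolding kronecker_product_form[OF assms(2) one_carrier_mat]
    by (intro sum.cong refl) (simp add: if_distrib if_distribR cong: if_cong)
  also have "\<dots> = (\<Sum>r<k. \<Sum>s<m. \<Sum>s'<m. A $$ (s, s') * x (s * k + r) * x (s' * k + r))"
    by (rule sum.swap)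
  also have "\<dots> < (\<Sum>r<k. 0)"
    using s neg_definite_form_nonpos[OF assms] neg_definiteD[OF assms, of "\<lambda>s. x (s * k + r)"]
    by (intro sum_strict_mono_ex1) auto
  finally show "(\<Sum>i<m * k. \<Sum>j<m * k. kronecker_product A (1\<^sub>m k) $$ (i, j) * x i * x j) < 0"
    by simp
qed

lemma D_x_carrier: "D_x pq \<alpha> K1 K2 N h \<tau> \<in> carrier_mat ((N - 1) * (N - 1)) ((N - 1) * (N - 1))"
  using wsgd_matrix_carrier[of pq \<alpha> N] by (simp add: D_x_def Let_def kronecker_product_carrier)

lemma D_y_carrier: "D_y pq \<beta> K1 K2 N h \<tau> \<in> carrier_mat ((N - 1) * (N - 1)) ((N - 1) * (N - 1))"
  using wsgd_matrix_carrier[of pq \<beta> N] by (simp add: D_y_def Let_def kronecker_product_carrier)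

lemma neg_definite_D:
  assumes "1 < \<gamma>" "\<gamma> \<le> 2" "pq \<in> {(1, 0), (1, -1)}"
    and "0 \<le> K1" "0 \<le> K2" "K1\<^sup>2 + K2\<^sup>2 \<noteq> 0" "0 < \<tau>" "0 < h"
  shows "neg_definite (D_x pq \<gamma> K1 K2 N h \<tau>)" "neg_definite (D_y pq \<gamma> K1 K2 N h \<tau>)"
proof -
  let ?B = "K1 \<cdot>\<^sub>m wsgd_matrix pq \<gamma> N + K2 \<cdot>\<^sub>m transpose_mat (wsgd_matrix pq \<gamma> N)"
  have B: "?B \<in> carrier_mat (N - 1) (N - 1)"
    using wsgd_matrix_carrier[of pq \<gamma> N] by simp
  have "0 < K1 + K2"
    using assms by (cases "K1 = 0"; cases "K2 = 0") auto
  then have neg: "neg_definite ?B"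
    using assms
    by (intro neg_definite_add_transpose[OF neg_definite_wsgd_matrix wsgd_matrix_carrier]) auto
  have c: "0 < \<tau> / (2 * h powr \<gamma>)"
    using assms by simp
  show "neg_definite (D_x pq \<gamma> K1 K2 N h \<tau>)" "neg_definite (D_y pq \<gamma> K1 K2 N h \<tau>)"
    unfolding D_x_def D_y_def Let_def
    using neg_definite_smult[OF neg_definite_kronecker_one_left[OF neg B]
        kronecker_product_carrier[OF one_carrier_mat B] c]
      neg_definite_smult[OF neg_definite_kronecker_one_right[OF neg B]
        kronecker_product_carrier[OF B one_carrier_mat] c]
    by auto
qed

subsection \<open>Spectral radius of the iteration matrix\<close>

text \<open>A kernel vector would satisfy X v = v, making the form at v equal to the nonnegative
  number \<open>v \<bullet> v\<close>.\<close>

lemma neg_definite_det_nonzero: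
  assumes "neg_definite X" and X: "X \<in> carrier_mat n n"
  shows "det (1\<^sub>m n - X) \<noteq> 0"
proof
  have IX: "1\<^sub>m n - X \<in> carrier_mat n n"
    using X by (rule minus_carrier_mat)
  assume "det (1\<^sub>m n - X) = 0"
  then obtain v where v: "v \<in> carrier_vec n" "v \<noteq> 0\<^sub>v n" "(1\<^sub>m n - X) *\<^sub>v v = 0\<^sub>v n"
    using det_0_iff_vec_prod_zero[OF IX] by auto
  have "v - X *\<^sub>v v = 0\<^sub>v n"
    using v X minus_mult_distrib_mat_vec[OF one_carrier_mat X v(1)] by simp
  then have "X *\<^sub>v v = v"
    using v X by (auto simp: vec_eq_iff)
  then have "v \<bullet> v < 0"
    using assms v by (auto simp: neg_definite_def)
  moreover have "0 \<le> v \<bullet> v"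
    by (simp add: scalar_prod_def sum_nonneg)
  ultimately show False by simp
qed

lemma det_nonzero_inverse:
  fixes A :: "'a :: field mat"
  assumes A: "A \<in> carrier_mat n n" and "det A \<noteq> 0"
  shows "invertible_mat A"
    and "the (mat_inverse A) \<in> carrier_mat n n"
    and "A * the (mat_inverse A) = 1\<^sub>m n"
proof -
  have "A \<in> Units (ring_mat TYPE('a) n ())"
    using det_non_zero_imp_unit[OF A] assms(2) by simp
  then obtain B where "mat_inverse A = Some B"
    using mat_inverse(1)[OF A, of "()"] by (cases "mat_inverse A") auto
  with mat_inverse(2)[OF A this]
  show "invertible_mat A" "the (mat_inverse A) \<in> carrier_mat n n" "A * the (mat_inverse A) = 1\<^sub>m n"
    using A by (auto simp: invertible_mat_def inverts_mat_def)
qed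

section \<open>Complex vectors and real negative definite matrices\<close>

text \<open>Since \<open>X\<close> is real, the products mixing real and imaginary parts of
  \<open>z\<close> contribute only to the imaginary part.\<close>

lemma Re_form_complex:
  fixes z :: "complex vec"
  assumes X: "X \<in> carrier_mat n n" and z: "z \<in> carrier_vec n"
  shows "(\<Sum>i<n. Re ((map_mat complex_of_real X *\<^sub>v z) $ i * cnj (z $ i))) =
    (\<Sum>i<n. \<Sum>j<n. X $$ (i, j) * Re (z $ i) * Re (z $ j)) +
    (\<Sum>i<n. \<Sum>j<n. X $$ (i, j) * Im (z $ i) * Im (z $ j))"
proof -
  have "Re ((map_mat complex_of_real X *\<^sub>v z) $ i * cnj (z $ i)) =
      (\<Sum>j<n. X $$ (i, j) * Re (z $ i) * Re (z $ j)) + (\<Sum>j<n. X $$ (i, j) * Im (z $ i) * Im (z $ j))"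
    if "i < n" for i
    using that X z
    by (simp add: scalar_prod_def lessThan_atLeast0 sum_distrib_left sum_distrib_right mult_ac)
  then show ?thesis
    by (simp add: sum.distrib)
qed

text \<open>Eigenvectors of the iteration matrix may be complex. The weak form serves a vector that
  may be zero, such as u' + \<mu> u; the strict one serves the eigenvector itself.\<close>

lemma neg_definite_Re_form:
  fixes z :: "complex vec"
  assumes "neg_definite X" and X: "X \<in> carrier_mat n n" and z: "z \<in> carrier_vec n"
  shows "(\<Sum>i<n. Re ((map_mat complex_of_real X *\<^sub>v z) $ i * cnj (z $ i))) \<le> 0"
    and "z \<noteq> 0\<^sub>v n \<Longrightarrow> (\<Sum>i<n. Re ((map_mat complex_of_real X *\<^sub>v z) $ i * cnj (z $ i))) < 0"
proof -
  note le = neg_definite_form_nonpos[OF assms(1,2)]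
  show "(\<Sum>i<n. Re ((map_mat complex_of_real X *\<^sub>v z) $ i * cnj (z $ i))) \<le> 0"
    unfolding Re_form_complex[OF X z] by (intro add_nonpos_nonpos le)
  assume "z \<noteq> 0\<^sub>v n"
  then obtain i where "i < n" "Re (z $ i) \<noteq> 0 \<or> Im (z $ i) \<noteq> 0"
    using z by (auto simp: vec_eq_iff complex_eq_iff)
  then show "(\<Sum>i<n. Re ((map_mat complex_of_real X *\<^sub>v z) $ i * cnj (z $ i))) < 0"
    unfolding Re_form_complex[OF X z]
    using neg_definiteD[OF assms(1,2), of "\<lambda>i. Re (z $ i)"] le[of "\<lambda>i. Im (z $ i)"]
      neg_definiteD[OF assms(1,2), of "\<lambda>i. Im (z $ i)"] le[of "\<lambda>i. Re (z $ i)"]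
    by (auto intro: add_neg_nonpos add_nonpos_neg)
qed

text \<open>The hypothesis \<open>eq\<close> says that \<open>u' - \<mu> u = - X (u' + \<mu> u)\<close>. Pairing with \<open>u' + \<mu> u\<close> gives \<open>|\<mu>| |u| \<le> |u'|\<close>, and
  \<open>|u'|\<^sup>2 - |u|\<^sup>2 = 4 Re \<langle>Y v, v\<rangle> < 0\<close>.\<close>

lemma generalized_eigenvalue_norm_less_1:
  fixes v :: "complex vec"
  assumes negX: "neg_definite X" and X: "X \<in> carrier_mat n n"
    and negY: "neg_definite Y" and Y: "Y \<in> carrier_mat n n"
    and v: "v \<in> carrier_vec n" "v \<noteq> 0\<^sub>v n"
    and u: "u = v - map_mat complex_of_real Y *\<^sub>v v" and u': "u' = v + map_mat complex_of_real Y *\<^sub>v v"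
    and eq: "u' + map_mat complex_of_real X *\<^sub>v u' = \<mu> \<cdot>\<^sub>v (u - map_mat complex_of_real X *\<^sub>v u)"
  shows "norm \<mu> < 1"
proof -
  let ?X = "map_mat complex_of_real X" and ?Y = "map_mat complex_of_real Y"
  have uc: "u \<in> carrier_vec n" and uc': "u' \<in> carrier_vec n"
    using v Y by (auto simp: u u')
  define z where "z = u' + \<mu> \<cdot>\<^sub>v u"
  have zc: "z \<in> carrier_vec n"
    using uc uc' by (simp add: z_def)
  have Xz: "?X *\<^sub>v z = ?X *\<^sub>v u' + \<mu> \<cdot>\<^sub>v (?X *\<^sub>v u)"
    using X uc uc' unfolding z_def
    by (simp add: mult_add_distrib_mat_vec[of _ n n] mult_mat_vec[of _ n n])
  have diff: "u' $ i - \<mu> * u $ i = - (?X *\<^sub>v z) $ i" if "i < n" for i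
  proof -
    have "(u' + ?X *\<^sub>v u') $ i = (\<mu> \<cdot>\<^sub>v (u - ?X *\<^sub>v u)) $ i"
      using eq by simp
    then have "u' $ i + (?X *\<^sub>v u') $ i = \<mu> * u $ i - \<mu> * (?X *\<^sub>v u) $ i"
      using that X uc uc' by (simp add: algebra_simps del: index_mult_mat_vec)
    then show ?thesis
      unfolding Xz using that X uc uc' by (simp add: algebra_simps del: index_mult_mat_vec)
  qed
  have "(\<Sum>i<n. (norm (u' $ i))\<^sup>2 - (norm \<mu>)\<^sup>2 * (norm (u $ i))\<^sup>2) =
      - (\<Sum>i<n. Re ((?X *\<^sub>v z) $ i * cnj (z $ i)))"
    unfolding sum_negf[symmetric]
  proof (intro sum.cong refl)
    fix i assume "i \<in> {..<n}"
    then have i: "i < n" by simp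
    have polar: "(norm a)\<^sup>2 - (norm b)\<^sup>2 = Re ((a - b) * cnj (a + b))" for a b :: complex
      by (simp add: cmod_power2 algebra_simps) (simp add: power2_eq_square algebra_simps)
    have "(norm (u' $ i))\<^sup>2 - (norm \<mu>)\<^sup>2 * (norm (u $ i))\<^sup>2 = (norm (u' $ i))\<^sup>2 - (norm (\<mu> * u $ i))\<^sup>2"
      by (simp add: norm_mult power_mult_distrib)
    also have "\<dots> = Re ((u' $ i - \<mu> * u $ i) * cnj (z $ i))"
      unfolding polar using i uc uc' by (simp add: z_def)
    also have "\<dots> = - Re ((?X *\<^sub>v z) $ i * cnj (z $ i))"
      unfolding diff[OF i] by (simp add: algebra_simps)
    finally show "(norm (u' $ i))\<^sup>2 - (norm \<mu>)\<^sup>2 * (norm (u $ i))\<^sup>2 =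
        - Re ((?X *\<^sub>v z) $ i * cnj (z $ i))" .
  qed
  then have ge: "(norm \<mu>)\<^sup>2 * (\<Sum>i<n. (norm (u $ i))\<^sup>2) \<le> (\<Sum>i<n. (norm (u' $ i))\<^sup>2)"
    using neg_definite_Re_form(1)[OF negX X zc] by (simp add: sum_subtractf sum_distrib_left)
  have "(\<Sum>i<n. (norm (u' $ i))\<^sup>2) - (\<Sum>i<n. (norm (u $ i))\<^sup>2) =
      4 * (\<Sum>i<n. Re ((?Y *\<^sub>v v) $ i * cnj (v $ i)))"
    unfolding sum_subtractf[symmetric] sum_distrib_left
  proof (intro sum.cong refl)
    fix i assume i: "i \<in> {..<n}"
    have "(norm (a + b))\<^sup>2 - (norm (a - b))\<^sup>2 = 4 * Re (b * cnj a)" for a b :: complex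
      by (simp add: cmod_power2 power2_sum power2_diff algebra_simps)
    then show "(norm (u' $ i))\<^sup>2 - (norm (u $ i))\<^sup>2 = 4 * Re ((?Y *\<^sub>v v) $ i * cnj (v $ i))"
      using i v Y by (simp add: u u' del: index_mult_mat_vec)
  qed
  then have less: "(\<Sum>i<n. (norm (u' $ i))\<^sup>2) < (\<Sum>i<n. (norm (u $ i))\<^sup>2)"
    using neg_definite_Re_form(2)[OF negY Y v] by simp
  show ?thesis
  proof (rule ccontr)
    assume "\<not> norm \<mu> < 1"
    then have "1 \<le> (norm \<mu>)\<^sup>2"
      by (simp add: one_le_power)
    \<comment> \<open>If |\<mu>| \<ge> 1, then |u|^2 \<le> |\<mu>|^2 |u|^2 \<le> |u'|^2 <
      |u|^2.\<close>
    then have "1 * (\<Sum>i<n. (norm (u $ i))\<^sup>2) \<le> (norm \<mu>)\<^sup>2 * (\<Sum>i<n. (norm (u $ i))\<^sup>2)"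
      by (intro mult_right_mono sum_nonneg) auto
    with ge less show False by simp
  qed
qed

lemma peaceman_rachford_spectral_radius:
  assumes negX: "neg_definite X" and X: "X \<in> carrier_mat n n"
    and negY: "neg_definite Y" and Y: "Y \<in> carrier_mat n n" and "0 < n"
  defines "I \<equiv> 1\<^sub>m n"
  shows "spectral_radius (map_mat complex_of_real
    (the (mat_inverse (I - Y)) * the (mat_inverse (I - X)) * (I + X) * (I + Y))) < 1"
proof -
  have Ic: "I \<in> carrier_mat n n"
    by (simp add: I_def)
  have IX: "I - X \<in> carrier_mat n n" "I + X \<in> carrier_mat n n"
    and IY: "I - Y \<in> carrier_mat n n" "I + Y \<in> carrier_mat n n"
    using X Y by (auto simp: I_def)
  define R S where "R = the (mat_inverse (I - X))" and "S = the (mat_inverse (I - Y))"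
  have R: "R \<in> carrier_mat n n" "(I - X) * R = 1\<^sub>m n"
    using det_nonzero_inverse[OF IX(1)] neg_definite_det_nonzero[OF negX X] by (auto simp: R_def I_def)
  have S: "S \<in> carrier_mat n n" "(I - Y) * S = 1\<^sub>m n"
    using det_nonzero_inverse[OF IY(1)] neg_definite_det_nonzero[OF negY Y] by (auto simp: S_def I_def)
  define M where "M = S * R * (I + X) * (I + Y)"
  have M: "M \<in> carrier_mat n n"
    unfolding M_def using R(1) S(1) IX IY by (intro mult_carrier_mat)
  have P: "(I + X) * (I + Y) \<in> carrier_mat n n"
    using IX(2) IY(2) by (rule mult_carrier_mat)
  \<comment> \<open>Multiplying by \<open>I - Y\<close> and then by \<open>I - X\<close> removes
    both inverses and leaves a generalized eigenvalue problem.\<close>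
  have "(I - X) * ((I - Y) * M) = (I - X) * ((I - Y) * (S * (R * ((I + X) * (I + Y)))))"
    using R S IX IY by (simp add: M_def assoc_mult_mat[of _ n n _ n _ n])
  also have "(I - Y) * (S * (R * ((I + X) * (I + Y)))) = R * ((I + X) * (I + Y))"
    unfolding assoc_mult_mat[OF IY(1) S(1) mult_carrier_mat[OF R(1) P], symmetric] S(2)
    by (rule left_mult_one_mat[OF mult_carrier_mat[OF R(1) P]])
  also have "(I - X) * (R * ((I + X) * (I + Y))) = (I + X) * (I + Y)"
    unfolding assoc_mult_mat[OF IX(1) R(1) P, symmetric] R(2) by (rule left_mult_one_mat[OF P])
  finally have M_eq: "(I - X) * ((I - Y) * M) = (I + X) * (I + Y)" .
  let ?C = "map_mat complex_of_real"
  have C_minus: "?C (I - A) *\<^sub>v w = w - ?C A *\<^sub>v w"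
    and C_plus: "?C (I + A) *\<^sub>v w = w + ?C A *\<^sub>v w"
    if "A \<in> carrier_mat n n" "w \<in> carrier_vec n" for A w
  proof -
    have "?C (I - A) = 1\<^sub>m n - ?C A" "?C (I + A) = 1\<^sub>m n + ?C A"
      using that(1) by (auto simp: I_def mat_eq_iff)
    then show "?C (I - A) *\<^sub>v w = w - ?C A *\<^sub>v w" "?C (I + A) *\<^sub>v w = w + ?C A *\<^sub>v w"
      using that by (simp_all add: minus_mult_distrib_mat_vec[of _ n n] add_mult_distrib_mat_vec[of _ n n])
  qed
  have C_mult: "?C (A * B) *\<^sub>v w = ?C A *\<^sub>v (?C B *\<^sub>v w)"
    if "A \<in> carrier_mat n n" "B \<in> carrier_mat n n" "w \<in> carrier_vec n" for A B w
    using that by (simp add: of_real_hom.mat_hom_mult[of _ n n _ n] assoc_mult_mat_vec[of _ n n _ n])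
  have IYM: "(I - Y) * M \<in> carrier_mat n n"
    using IY(1) M by (rule mult_carrier_mat)
  have "norm \<mu> < 1" if ev: "eigenvalue (?C M) \<mu>" for \<mu>
  proof -
    obtain v where v: "v \<in> carrier_vec n" "v \<noteq> 0\<^sub>v n" "?C M *\<^sub>v v = \<mu> \<cdot>\<^sub>v v"
      using ev M by (auto simp: eigenvalue_def eigenvector_def)
    let ?u = "v - ?C Y *\<^sub>v v" and ?u' = "v + ?C Y *\<^sub>v v"
    have uc: "?u \<in> carrier_vec n" "?u' \<in> carrier_vec n"
      using v Y by auto
    have "?u' + ?C X *\<^sub>v ?u' = ?C ((I + X) * (I + Y)) *\<^sub>v v"
      unfolding C_mult[OF IX(2) IY(2) v(1)] C_plus[OF Y v(1)] C_plus[OF X uc(2)] ..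
    also have "\<dots> = ?C (I - X) *\<^sub>v (?C (I - Y) *\<^sub>v (?C M *\<^sub>v v))"
      unfolding M_eq[symmetric] C_mult[OF IX(1) IYM v(1)] C_mult[OF IY(1) M v(1)] ..
    also have "\<dots> = \<mu> \<cdot>\<^sub>v (?C (I - X) *\<^sub>v (?C (I - Y) *\<^sub>v v))"
      unfolding v(3) using IX IY v
      by (simp add: mult_mat_vec[of _ n n])
    also have "\<dots> = \<mu> \<cdot>\<^sub>v (?u - ?C X *\<^sub>v ?u)"
      using X Y v uc by (simp add: C_minus)
    finally show ?thesis
      by (rule generalized_eigenvalue_norm_less_1[OF negX X negY Y v(1,2) refl refl])
  qed
  \<comment> \<open>For \<open>0 < n\<close> the spectrum is nonempty and the spectral radius is
    attained at an eigenvalue.\<close>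
  moreover have "spectral_radius (?C M) \<in> norm ` spectrum (?C M)"
    using M \<open>0 < n\<close> by (intro spectral_radius_mem_max(1)) auto
  ultimately show ?thesis
    unfolding M_def[unfolded R_def S_def] by (auto simp: spectrum_def M_def R_def S_def)
qed

section \<open>Stability of the CN-WSGD iteration matrix\<close>

lemma cn_wsgd_stable:
  assumes "1 < \<alpha>" "\<alpha> \<le> 2" "1 < \<beta>" "\<beta> \<le> 2" "pq \<in> {(1, 0), (1, -1)}"
    and "0 \<le> K1p" "0 \<le> K2p" "0 \<le> K1m" "0 \<le> K2m"
    and "K1p\<^sup>2 + K2p\<^sup>2 \<noteq> 0" "K1m\<^sup>2 + K2m\<^sup>2 \<noteq> 0"
  shows "cn_wsgd_unconditionally_stable pq \<alpha> \<beta> K1p K2p K1m K2m"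
  unfolding cn_wsgd_unconditionally_stable_def Let_def
proof (intro allI impI)
  fix N :: nat and \<tau> h :: real
  assume *: "2 \<le> N \<and> 0 < \<tau> \<and> 0 < h"
  let ?n = "(N - 1) * (N - 1)"
  let ?X = "D_x pq \<alpha> K1p K2p N h \<tau>" and ?Y = "D_y pq \<beta> K1m K2m N h \<tau>"
  have neg: "neg_definite ?X" "neg_definite ?Y"
    using assms * by (auto intro!: neg_definite_D)
  have X: "1\<^sub>m ?n - ?X \<in> carrier_mat ?n ?n" and Y: "1\<^sub>m ?n - ?Y \<in> carrier_mat ?n ?n"
    using D_x_carrier D_y_carrier by (simp_all add: minus_carrier_mat)
  have "0 < ?n"
    using * by simp
  then show "invertible_mat (1\<^sub>m ?n - ?X) \<and> invertible_mat (1\<^sub>m ?n - ?Y) \<and>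
      spectral_radius (map_mat complex_of_real (the (mat_inverse (1\<^sub>m ?n - ?Y)) *
        the (mat_inverse (1\<^sub>m ?n - ?X)) * (1\<^sub>m ?n + ?X) * (1\<^sub>m ?n + ?Y))) < 1"
    using det_nonzero_inverse(1)[OF X] neg_definite_det_nonzero[OF neg(1) D_x_carrier]
      det_nonzero_inverse(1)[OF Y] neg_definite_det_nonzero[OF neg(2) D_y_carrier]
      peaceman_rachford_spectral_radius[OF neg(1) D_x_carrier neg(2) D_y_carrier]
    by blast
qed

subsection \<open>Error recurrence\<close>

lemma delta_x_diff:
  "delta_x pq \<alpha> K1 K2 N h (\<lambda>i j. U i j - V i j) i j =
    delta_x pq \<alpha> K1 K2 N h U i j - delta_x pq \<alpha> K1 K2 N h V i j"
  by (simp add: delta_x_def sum_subtractf algebra_simps)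

lemma delta_y_diff:
  "delta_y pq \<beta> K1 K2 N h (\<lambda>i j. U i j - V i j) i j =
    delta_y pq \<beta> K1 K2 N h U i j - delta_y pq \<beta> K1 K2 N h V i j"
  by (simp add: delta_y_def sum_subtractf algebra_simps)

text \<open>The matrix rows see only the interior grid points, so the boundary values have to vanish.\<close>

lemma wsgd_matrix_stencil:
  assumes i: "i < N - 1" and "u 0 = 0" "u N = 0"
  shows "(\<Sum>l<N - 1. (K1 \<cdot>\<^sub>m wsgd_matrix pq \<gamma> N + K2 \<cdot>\<^sub>m transpose_mat (wsgd_matrix pq \<gamma> N)) $$ (i, l) * u (l + 1)) =
    K1 * (\<Sum>k = 0..i + 1 + 1. wsgd_weight pq \<gamma> k * u (i + 1 + 1 - k)) +
    K2 * (\<Sum>k = 0..N - (i + 1) + 1. wsgd_weight pq \<gamma> k * u (i + 1 + k - 1))"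
proof -
  have interior: "(\<Sum>j\<le>N. f j) = (\<Sum>l<N - 1. f (l + 1))" if "f 0 = 0" "f N = 0" for f :: "nat \<Rightarrow> real"
  proof -
    obtain m where N: "N = Suc (Suc m)"
      using i by (intro that[of "N - 2"]) auto
    have "(\<Sum>j\<le>N. f j) = (\<Sum>j<N. f j)"
      using that by (simp add: lessThan_Suc_atMost[symmetric])
    then show ?thesis
      unfolding N using that by (simp add: N sum.lessThan_Suc_shift del: sum.lessThan_Suc)
  qed
  let ?w = "wsgd_weight pq \<gamma>"
  \<comment> \<open>Matrix index \<open>l\<close> is grid index \<open>l + 1\<close>, which turns
    the offset \<open>i + 1\<close> into \<open>i + 2\<close>.\<close>
  have "(\<Sum>l<N - 1. (if l \<le> i + 1 then ?w (i + 1 - l) else 0) * u (l + 1)) =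
      (\<Sum>j\<le>N. (if j \<le> i + 2 then ?w (i + 2 - j) else 0) * u j)"
    using assms by (subst interior) (auto intro!: sum.cong)
  also have "\<dots> = (\<Sum>j\<le>i + 2. ?w (i + 2 - j) * u j)"
    using i by (intro sum.mono_neutral_cong_right) auto
  also have "\<dots> = (\<Sum>k = 0..i + 1 + 1. ?w k * u (i + 1 + 1 - k))"
    by (rule sum.reindex_bij_witness[of _ "\<lambda>k. i + 2 - k" "\<lambda>j. i + 2 - j"]) auto
  finally have 1: "(\<Sum>l<N - 1. (if l \<le> i + 1 then ?w (i + 1 - l) else 0) * u (l + 1)) =
      (\<Sum>k = 0..i + 1 + 1. ?w k * u (i + 1 + 1 - k))" .
  have "(\<Sum>l<N - 1. (if i \<le> l + 1 then ?w (l + 1 - i) else 0) * u (l + 1)) =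
      (\<Sum>j\<le>N. (if i \<le> j then ?w (j - i) else 0) * u j)"
    using assms by (subst interior) (auto intro!: sum.cong)
  also have "\<dots> = (\<Sum>j\<in>{i..N}. ?w (j - i) * u j)"
    by (intro sum.mono_neutral_cong_right) auto
  also have "\<dots> = (\<Sum>k = 0..N - (i + 1) + 1. ?w k * u (i + 1 + k - 1))"
    using i by (intro sum.reindex_bij_witness[of _ "\<lambda>k. i + k" "\<lambda>j. j - i"]) auto
  finally have 2: "(\<Sum>l<N - 1. (if i \<le> l + 1 then ?w (l + 1 - i) else 0) * u (l + 1)) =
      (\<Sum>k = 0..N - (i + 1) + 1. ?w k * u (i + 1 + k - 1))" .
  have "(\<Sum>l<N - 1. (K1 \<cdot>\<^sub>m wsgd_matrix pq \<gamma> N + K2 \<cdot>\<^sub>m transpose_mat (wsgd_matrix pq \<gamma> N)) $$ (i, l) * u (l + 1)) =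
      K1 * (\<Sum>l<N - 1. (if l \<le> i + 1 then ?w (i + 1 - l) else 0) * u (l + 1)) +
      K2 * (\<Sum>l<N - 1. (if i \<le> l + 1 then ?w (l + 1 - i) else 0) * u (l + 1))"
    using i by (simp add: wsgd_matrix_def sum_distrib_left sum.distrib algebra_simps)
  then show ?thesis
    unfolding 1 2 .
qed

section \<open>Action of the matrices on grid functions\<close>

lemma kronecker_product_mult_vec:
  fixes g :: "nat \<Rightarrow> nat \<Rightarrow> 'a :: semiring_1"
  assumes A: "A \<in> carrier_mat m m" and B: "B \<in> carrier_mat k k" and l: "l < m * k"
  shows "(kronecker_product A B *\<^sub>v vec (m * k) (\<lambda>l. g (l mod k) (l div k))) $ l =
    (\<Sum>s<m. \<Sum>r<k. A $$ (l div k, s) * B $$ (l mod k, r) * g r s)"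
proof -
  have "(kronecker_product A B *\<^sub>v vec (m * k) (\<lambda>l. g (l mod k) (l div k))) $ l =
      (\<Sum>l'<m * k. (\<lambda>s r. A $$ (l div k, s) * B $$ (l mod k, r) * g r s) (l' div k) (l' mod k))"
    using assms
    by (auto simp: kronecker_product_def scalar_prod_def lessThan_atLeast0 intro!: sum.cong)
  also have "\<dots> = (\<Sum>s<m. \<Sum>r<k. A $$ (l div k, s) * B $$ (l mod k, r) * g r s)"
    by (rule sum_div_mod)
  finally show ?thesis .
qed

lemma smult_mat_vec_index:
  assumes "A \<in> carrier_mat n k" "v \<in> carrier_vec k" "l < n"
  shows "((c \<cdot>\<^sub>m A) *\<^sub>v v) $ l = c * (A *\<^sub>v v) $ l"
  using assms by (simp add: row_smult smult_scalar_prod_distrib[of _ k])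

lemma grid_vec_carrier: "grid_vec N e \<in> carrier_vec ((N - 1) * (N - 1))"
  by (simp add: grid_vec_def)

lemma grid_vec_index:
  "l < (N - 1) * (N - 1) \<Longrightarrow> grid_vec N e $ l = e (l mod (N - 1) + 1) (l div (N - 1) + 1)"
  by (simp add: grid_vec_def)

lemma grid_vec_cong:
  assumes "\<And>i j. 1 \<le> i \<Longrightarrow> i \<le> N - 1 \<Longrightarrow> 1 \<le> j \<Longrightarrow> j \<le> N - 1 \<Longrightarrow> e i j = e' i j"
  shows "grid_vec N e = grid_vec N e'"
proof (rule eq_vecI)
  fix l assume "l < dim_vec (grid_vec N e')"
  then have l: "l < (N - 1) * (N - 1)"
    by (simp add: grid_vec_def)
  have "l div (N - 1) < N - 1" "l mod (N - 1) < N - 1"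
    using div_mod_less[OF l] by auto
  then have "e (l mod (N - 1) + 1) (l div (N - 1) + 1) = e' (l mod (N - 1) + 1) (l div (N - 1) + 1)"
    by (intro assms) linarith+
  then show "grid_vec N e $ l = grid_vec N e' $ l"
    using l by (simp add: grid_vec_def)
qed (simp add: grid_vec_def)

text \<open>The identity factor fixes the slow index, leaving the one-dimensional stencil along a
  grid line. Boundary zeros are asked for interior \<open>j\<close> only, since the lemma is later
  applied to an intermediate function shown to vanish just there.\<close>

lemma D_x_mult_grid_vec:
  assumes "\<And>j. 1 \<le> j \<Longrightarrow> j \<le> N - 1 \<Longrightarrow> e 0 j = 0" "\<And>j. 1 \<le> j \<Longrightarrow> j \<le> N - 1 \<Longrightarrow> e N j = 0"
  shows "D_x pq \<alpha> K1 K2 N h \<tau> *\<^sub>v grid_vec N e = grid_vec N (\<lambda>i j. \<tau> / 2 * delta_x pq \<alpha> K1 K2 N h e i j)"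
proof (rule eq_vecI)
  fix l assume "l < dim_vec (grid_vec N (\<lambda>i j. \<tau> / 2 * delta_x pq \<alpha> K1 K2 N h e i j))"
  then have l: "l < (N - 1) * (N - 1)"
    by (simp add: grid_vec_def)
  have scale: "\<tau> / (2 * p) * S = \<tau> / 2 * (1 / p * S)" for p S :: real
    by simp
  let ?i = "l mod (N - 1)" and ?j = "l div (N - 1)"
  have lt: "?j < N - 1" "?i < N - 1"
    using div_mod_less[OF l] by auto
  let ?B = "K1 \<cdot>\<^sub>m wsgd_matrix pq \<alpha> N + K2 \<cdot>\<^sub>m transpose_mat (wsgd_matrix pq \<alpha> N)"
  have B: "?B \<in> carrier_mat (N - 1) (N - 1)"
    using wsgd_matrix_carrier[of pq \<alpha> N] by simp
  have K: "kronecker_product (1\<^sub>m (N - 1)) ?B \<in> carrier_mat ((N - 1) * (N - 1)) ((N - 1) * (N - 1))"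
    by (rule kronecker_product_carrier[OF one_carrier_mat B])
  have "(D_x pq \<alpha> K1 K2 N h \<tau> *\<^sub>v grid_vec N e) $ l =
      \<tau> / (2 * h powr \<alpha>) * (kronecker_product (1\<^sub>m (N - 1)) ?B *\<^sub>v grid_vec N e) $ l"
    unfolding D_x_def Let_def by (rule smult_mat_vec_index[OF K grid_vec_carrier l])
  also have "(kronecker_product (1\<^sub>m (N - 1)) ?B *\<^sub>v grid_vec N e) $ l =
      (\<Sum>s<N - 1. \<Sum>r<N - 1. 1\<^sub>m (N - 1) $$ (?j, s) * ?B $$ (?i, r) * e (r + 1) (s + 1))"
    unfolding grid_vec_def by (rule kronecker_product_mult_vec[OF one_carrier_mat B l])
  also have "\<dots> = (\<Sum>r<N - 1. ?B $$ (?i, r) * e (r + 1) (?j + 1))"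
    using lt by (subst sum.swap) (simp add: if_distrib if_distribR cong: if_cong)
  also have "\<dots> = K1 * (\<Sum>k = 0..?i + 1 + 1. wsgd_weight pq \<alpha> k * e (?i + 1 + 1 - k) (?j + 1)) +
      K2 * (\<Sum>k = 0..N - (?i + 1) + 1. wsgd_weight pq \<alpha> k * e (?i + 1 + k - 1) (?j + 1))"
    by (rule wsgd_matrix_stencil[OF lt(2)]; intro assms) (use lt in linarith)+
  finally show "(D_x pq \<alpha> K1 K2 N h \<tau> *\<^sub>v grid_vec N e) $ l =
      grid_vec N (\<lambda>i j. \<tau> / 2 * delta_x pq \<alpha> K1 K2 N h e i j) $ l"
    unfolding grid_vec_index[OF l] delta_x_def by (rule trans) (rule scale)
qed (simp add: grid_vec_def carrier_matD(1)[OF D_x_carrier])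

lemma D_y_mult_grid_vec:
  assumes "\<And>i. 1 \<le> i \<Longrightarrow> i \<le> N - 1 \<Longrightarrow> e i 0 = 0" "\<And>i. 1 \<le> i \<Longrightarrow> i \<le> N - 1 \<Longrightarrow> e i N = 0"
  shows "D_y pq \<beta> K1 K2 N h \<tau> *\<^sub>v grid_vec N e = grid_vec N (\<lambda>i j. \<tau> / 2 * delta_y pq \<beta> K1 K2 N h e i j)"
proof (rule eq_vecI)
  fix l assume "l < dim_vec (grid_vec N (\<lambda>i j. \<tau> / 2 * delta_y pq \<beta> K1 K2 N h e i j))"
  then have l: "l < (N - 1) * (N - 1)"
    by (simp add: grid_vec_def)
  have scale: "\<tau> / (2 * p) * S = \<tau> / 2 * (1 / p * S)" for p S :: real
    by simp
  let ?i = "l mod (N - 1)" and ?j = "l div (N - 1)"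
  have lt: "?j < N - 1" "?i < N - 1"
    using div_mod_less[OF l] by auto
  let ?B = "K1 \<cdot>\<^sub>m wsgd_matrix pq \<beta> N + K2 \<cdot>\<^sub>m transpose_mat (wsgd_matrix pq \<beta> N)"
  have B: "?B \<in> carrier_mat (N - 1) (N - 1)"
    using wsgd_matrix_carrier[of pq \<beta> N] by simp
  have K: "kronecker_product ?B (1\<^sub>m (N - 1)) \<in> carrier_mat ((N - 1) * (N - 1)) ((N - 1) * (N - 1))"
    by (rule kronecker_product_carrier[OF B one_carrier_mat])
  have "(D_y pq \<beta> K1 K2 N h \<tau> *\<^sub>v grid_vec N e) $ l =
      \<tau> / (2 * h powr \<beta>) * (kronecker_product ?B (1\<^sub>m (N - 1)) *\<^sub>v grid_vec N e) $ l"
    unfolding D_y_def Let_def by (rule smult_mat_vec_index[OF K grid_vec_carrier l])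
  also have "(kronecker_product ?B (1\<^sub>m (N - 1)) *\<^sub>v grid_vec N e) $ l =
      (\<Sum>s<N - 1. \<Sum>r<N - 1. ?B $$ (?j, s) * 1\<^sub>m (N - 1) $$ (?i, r) * e (r + 1) (s + 1))"
    unfolding grid_vec_def by (rule kronecker_product_mult_vec[OF B one_carrier_mat l])
  also have "\<dots> = (\<Sum>s<N - 1. ?B $$ (?j, s) * e (?i + 1) (s + 1))"
    using lt by (simp add: if_distrib if_distribR cong: if_cong)
  also have "\<dots> = K1 * (\<Sum>k = 0..?j + 1 + 1. wsgd_weight pq \<beta> k * e (?i + 1) (?j + 1 + 1 - k)) +
      K2 * (\<Sum>k = 0..N - (?j + 1) + 1. wsgd_weight pq \<beta> k * e (?i + 1) (?j + 1 + k - 1))"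
    by (rule wsgd_matrix_stencil[OF lt(1)]; intro assms) (use lt in linarith)+
  finally show "(D_y pq \<beta> K1 K2 N h \<tau> *\<^sub>v grid_vec N e) $ l =
      grid_vec N (\<lambda>i j. \<tau> / 2 * delta_y pq \<beta> K1 K2 N h e i j) $ l"
    unfolding grid_vec_index[OF l] delta_y_def by (rule trans) (rule scale)
qed (simp add: grid_vec_def carrier_matD(1)[OF D_y_carrier])

lemma grid_vec_add: "grid_vec N (\<lambda>i j. e i j + e' i j) = grid_vec N e + grid_vec N e'"
  by (auto simp: grid_vec_def)

text \<open>\<open>\<sigma>\<close> is \<open>\<tau>\<close> or \<open>- \<tau>\<close>, which covers both sides of the scheme.\<close>

lemma factored_scheme_grid_vec:
  fixes pq and e :: "nat \<Rightarrow> nat \<Rightarrow> real" and \<beta> K1m K2m h \<sigma> :: real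
  assumes bd: "\<And>i j. i \<le> N \<Longrightarrow> j \<le> N \<Longrightarrow> i = 0 \<or> i = N \<or> j = 0 \<or> j = N \<Longrightarrow> e i j = 0"
  defines "F \<equiv> \<lambda>i j. e i j + \<sigma> / 2 * delta_y pq \<beta> K1m K2m N h e i j"
  defines "I \<equiv> 1\<^sub>m ((N - 1) * (N - 1))"
  shows "((I + D_x pq \<alpha> K1p K2p N h \<sigma>) * (I + D_y pq \<beta> K1m K2m N h \<sigma>)) *\<^sub>v grid_vec N e =
    grid_vec N (\<lambda>i j. F i j + \<sigma> / 2 * delta_x pq \<alpha> K1p K2p N h F i j)"
proof -
  let ?n = "(N - 1) * (N - 1)"
  let ?X = "D_x pq \<alpha> K1p K2p N h \<sigma>" and ?Y = "D_y pq \<beta> K1m K2m N h \<sigma>"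
  \<comment> \<open>On the edges \<open>i = 0\<close> and \<open>i = N\<close> the operator in y
    combines only values of \<open>e\<close> on the same edge, all zero; so the x-matrix may be
    applied to \<open>F\<close>.\<close>
  have F0: "F 0 j = 0" "F N j = 0" if "1 \<le> j" "j \<le> N - 1" for j
    using that by (auto simp: F_def delta_y_def bd intro!: sum.neutral)
  have "((I + ?X) * (I + ?Y)) *\<^sub>v grid_vec N e = (I + ?X) *\<^sub>v ((I + ?Y) *\<^sub>v grid_vec N e)"
    unfolding I_def
    by (rule assoc_mult_mat_vec[OF add_carrier_mat[OF D_x_carrier] add_carrier_mat[OF D_y_carrier]
          grid_vec_carrier])
  also have "(I + ?Y) *\<^sub>v grid_vec N e = grid_vec N F"
    unfolding I_def F_def grid_vec_add one_mult_mat_vec[OF grid_vec_carrier]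
      add_mult_distrib_mat_vec[OF one_carrier_mat D_y_carrier grid_vec_carrier]
    by (subst D_y_mult_grid_vec) (auto simp: bd)
  also have "(I + ?X) *\<^sub>v grid_vec N F =
      grid_vec N (\<lambda>i j. F i j + \<sigma> / 2 * delta_x pq \<alpha> K1p K2p N h F i j)"
    unfolding I_def grid_vec_add one_mult_mat_vec[OF grid_vec_carrier]
      add_mult_distrib_mat_vec[OF one_carrier_mat D_x_carrier grid_vec_carrier]
    by (subst D_x_mult_grid_vec) (auto simp: F0)
  finally show ?thesis .
qed

lemma D_uminus:
  "D_x pq \<alpha> K1 K2 N h (- \<tau>) = - D_x pq \<alpha> K1 K2 N h \<tau>"
  "D_y pq \<beta> K1 K2 N h (- \<tau>) = - D_y pq \<beta> K1 K2 N h \<tau>"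
  by (auto simp: D_x_def D_y_def Let_def)

text \<open>The two solutions share source and boundary data and may differ in initial data: in the
  difference the source cancels and the boundary values vanish, so the matrices represent the scheme
  exactly.\<close>

lemma cn_wsgd_error_recurrence:
  assumes U: "cn_wsgd_solution pq \<alpha> \<beta> K1p K2p K1m K2m a c N M h \<tau> u0 \<phi> f U"
    and V: "cn_wsgd_solution pq \<alpha> \<beta> K1p K2p K1m K2m a c N M h \<tau> v0 \<phi> f V"
    and "n < M"
  defines "X \<equiv> D_x pq \<alpha> K1p K2p N h \<tau>" and "Y \<equiv> D_y pq \<beta> K1m K2m N h \<tau>"
    and "I \<equiv> 1\<^sub>m ((N - 1) * (N - 1))"
    and "e \<equiv> \<lambda>n i j. U n i j - V n i j"
  shows "((I - X) * (I - Y)) *\<^sub>v grid_vec N (e (n + 1)) = ((I + X) * (I + Y)) *\<^sub>v grid_vec N (e n)"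
proof -
  let ?dx = "delta_x pq \<alpha> K1p K2p N h" and ?dy = "delta_y pq \<beta> K1m K2m N h"
  define F where "F \<sigma> W i j = W i j + \<sigma> / 2 * ?dy W i j" for \<sigma> W i j
  have F_diff: "F \<sigma> (\<lambda>i j. W i j - W' i j) = (\<lambda>i j. F \<sigma> W i j - F \<sigma> W' i j)" for \<sigma> W W'
    by (simp add: F_def fun_eq_iff delta_y_diff algebra_simps)
  have bd: "e m i j = 0" if "m \<le> M" "i \<le> N" "j \<le> N" "i = 0 \<or> i = N \<or> j = 0 \<or> j = N" for m i j
    using U V that by (simp add: cn_wsgd_solution_def Let_def e_def)
  have step: "F (- \<tau>) W' i j - \<tau> / 2 * ?dx (F (- \<tau>) W') i j =
      F \<tau> W i j + \<tau> / 2 * ?dx (F \<tau> W) i j + \<tau> * f (a + real i * h) (c + real j * h) ((real n * \<tau> + real (n + 1) * \<tau>) / 2)"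
    if "cn_wsgd_solution pq \<alpha> \<beta> K1p K2p K1m K2m a c N M h \<tau> w0 \<phi> f Z" "W' = Z (n + 1)" "W = Z n"
      "1 \<le> i" "i \<le> N - 1" "1 \<le> j" "j \<le> N - 1" for w0 Z W W' i j
    using that \<open>n < M\<close> unfolding cn_wsgd_solution_def Let_def F_def by simp
  have "I - X = I + D_x pq \<alpha> K1p K2p N h (- \<tau>)" "I - Y = I + D_y pq \<beta> K1m K2m N h (- \<tau>)"
    by (auto simp: X_def Y_def I_def D_uminus minus_add_uminus_mat[OF _ D_x_carrier]
        minus_add_uminus_mat[OF _ D_y_carrier])
  then have "((I - X) * (I - Y)) *\<^sub>v grid_vec N (e (n + 1)) =
      grid_vec N (\<lambda>i j. F (- \<tau>) (e (n + 1)) i j + - \<tau> / 2 * ?dx (F (- \<tau>) (e (n + 1))) i j)"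
    using factored_scheme_grid_vec[where e = "e (n + 1)" and \<sigma> = "- \<tau>" and N = N] bd \<open>n < M\<close>
    by (simp add: I_def F_def[abs_def])
  also have "\<dots> = grid_vec N (\<lambda>i j. F \<tau> (e n) i j + \<tau> / 2 * ?dx (F \<tau> (e n)) i j)"
  proof (rule grid_vec_cong)
    fix i j assume ij: "1 \<le> i" "i \<le> N - 1" "1 \<le> j" "j \<le> N - 1"
    show "F (- \<tau>) (e (n + 1)) i j + - \<tau> / 2 * ?dx (F (- \<tau>) (e (n + 1))) i j =
        F \<tau> (e n) i j + \<tau> / 2 * ?dx (F \<tau> (e n)) i j"
      using step[OF U refl refl ij] step[OF V refl refl ij]
      unfolding e_def F_diff delta_x_diff by (simp add: algebra_simps)
  qed
  also have "\<dots> = ((I + X) * (I + Y)) *\<^sub>v grid_vec N (e n)"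
    using factored_scheme_grid_vec[where e = "e n" and \<sigma> = \<tau> and N = N] bd \<open>n < M\<close>
    by (simp add: I_def X_def Y_def F_def[abs_def])
  finally show ?thesis .
qed

text \<open>The recurrence ties the matrices to the scheme on its actual grids; the stability
  statement then lets \<tau>, h and N vary independently.\<close>

theorem theorem6:
  fixes \<alpha> \<beta> K1p K2p K1m K2m a b c d T :: real
    and p q :: int
    and \<phi> f :: "real \<Rightarrow> real \<Rightarrow> real \<Rightarrow> real"
  assumes "1 < \<alpha>" "\<alpha> \<le> 2" "1 < \<beta>" "\<beta> \<le> 2"
    and "0 \<le> K1p" "0 \<le> K2p" "0 \<le> K1m" "0 \<le> K2m"
    and "K1p\<^sup>2 + K2p\<^sup>2 \<noteq> 0" "K1m\<^sup>2 + K2m\<^sup>2 \<noteq> 0"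
    and "(p, q) \<in> {(1, 0), (1, -1)}"
    and "a < b" "c < d" "b - a = d - c" "0 < T"
    and "K1p \<noteq> 0 \<longrightarrow> (\<forall>y\<in>{c..d}. \<forall>t\<in>{0..T}. \<phi> a y t = 0)"
    and "K2p \<noteq> 0 \<longrightarrow> (\<forall>y\<in>{c..d}. \<forall>t\<in>{0..T}. \<phi> b y t = 0)"
    and "K1m \<noteq> 0 \<longrightarrow> (\<forall>x\<in>{a..b}. \<forall>t\<in>{0..T}. \<phi> x c t = 0)"
    and "K2m \<noteq> 0 \<longrightarrow> (\<forall>x\<in>{a..b}. \<forall>t\<in>{0..T}. \<phi> x d t = 0)"
  shows
    "(\<forall>N M h \<tau> u0 v0 U V.
        2 \<le> N \<and> 1 \<le> M \<and> h = (b - a) / real N \<and> \<tau> = T / real M \<and>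
        cn_wsgd_solution (p, q) \<alpha> \<beta> K1p K2p K1m K2m a c N M h \<tau> u0 \<phi> f U \<and>
        cn_wsgd_solution (p, q) \<alpha> \<beta> K1p K2p K1m K2m a c N M h \<tau> v0 \<phi> f V \<longrightarrow>
        (let Dx = D_x (p, q) \<alpha> K1p K2p N h \<tau>;
             Dy = D_y (p, q) \<beta> K1m K2m N h \<tau>;
             I = 1\<^sub>m ((N - 1) * (N - 1));
             e = (\<lambda>n. grid_vec N (\<lambda>i j. U n i j - V n i j))
         in \<forall>n < M. ((I - Dx) * (I - Dy)) *\<^sub>v e (n + 1) = ((I + Dx) * (I + Dy)) *\<^sub>v e n)) \<and>
     cn_wsgd_unconditionally_stable (p, q) \<alpha> \<beta> K1p K2p K1m K2m"
proof (intro conjI allI impI)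
  show "cn_wsgd_unconditionally_stable (p, q) \<alpha> \<beta> K1p K2p K1m K2m"
    using assms by (intro cn_wsgd_stable) auto
next
  fix N M :: nat and h \<tau> :: real and u0 v0 :: "real \<Rightarrow> real \<Rightarrow> real" and U V :: "nat \<Rightarrow> nat \<Rightarrow> nat \<Rightarrow> real"
  assume "2 \<le> N \<and> 1 \<le> M \<and> h = (b - a) / real N \<and> \<tau> = T / real M \<and>
    cn_wsgd_solution (p, q) \<alpha> \<beta> K1p K2p K1m K2m a c N M h \<tau> u0 \<phi> f U \<and>
    cn_wsgd_solution (p, q) \<alpha> \<beta> K1p K2p K1m K2m a c N M h \<tau> v0 \<phi> f V"
  then have U: "cn_wsgd_solution (p, q) \<alpha> \<beta> K1p K2p K1m K2m a c N M h \<tau> u0 \<phi> f U"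
    and V: "cn_wsgd_solution (p, q) \<alpha> \<beta> K1p K2p K1m K2m a c N M h \<tau> v0 \<phi> f V"
    by auto
  show "let Dx = D_x (p, q) \<alpha> K1p K2p N h \<tau>;
      Dy = D_y (p, q) \<beta> K1m K2m N h \<tau>;
      I = 1\<^sub>m ((N - 1) * (N - 1));
      e = (\<lambda>n. grid_vec N (\<lambda>i j. U n i j - V n i j))
    in \<forall>n < M. ((I - Dx) * (I - Dy)) *\<^sub>v e (n + 1) = ((I + Dx) * (I + Dy)) *\<^sub>v e n"
    unfolding Let_def by (intro allI impI cn_wsgd_error_recurrence[OF U V])
qed

end
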